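(* Let $A\in\mathbb{R}^{m\times n}$ with $m\ge n$ and $\operatorname{rank}(A)=n$, let $b\in\mathbb{R}^m$ be such that $Ax=b$ is consistent with solution $x^*$, let $G\in\mathbb{R}^{n\times n}$ be symmetric positive definite, and let $1\le l\le n$. Let $\Omega_0,\Omega_1,\dots\in\mathbb{R}^{m\times l}$ be independent random matrices with i.i.d. $N(0,1)$ entries, and let $$T_j:=I_n-GA^T\Omega_j(\Omega_j^TAGA^T\Omega_j)^{-1}\Omega_j^TA,$$ so that the iteration $x^{k+1}=x^k+GA^T\Omega_k(\Omega_k^TAGA^T\Omega_k)^{-1}\Omega_k^T(b-Ax^k)$ has errors $e^{k+1}:=x^{k+1}-x^*=T_k\cdots T_0e^0$ with $e^0=x^0-x^*$ deterministic. Let $\kappa:=\lambda_{\max}(G^{1/2}A^TAG^{1/2})/\lambda_{\min}(G^{1/2}A^TAG^{1/2})$ and $\rho:=1-\frac{1}{m\kappa}$. Then $\rho<1$ and for every $k\ge0$ $$\mathbb{E}\big[\|T_k\cdots T_0e^0\|_{G^{-1}}^2\big]\le\rho\,\mathbb{E}\big[\|T_{k-1}\cdots T_0e^0\|_{G^{-1}}^2\big],\qquad \mathbb{E}\big[\|T_k\cdots T_0e^0\|_{G^{-1}}^2\big]\le\rho^{k+1}\|e^0\|_{G^{-1}}^2,$$ (with the empty product equal to $I_n$); in particular $\mathbb{E}\|x^k-x^*\|_{G^{-1}}^2\to0$ as $k\to\infty$.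
   Context: For symmetric positive definite $M$, $\|x\|_M:=\sqrt{x^TMx}$. $\lambda_{\max},\lambda_{\min}$ denote the largest and smallest eigenvalues. *)

theory Defs
  imports "HOL-Analysis.Analysis" "HOL-Probability.Probability"
begin

definition sqnormM :: "real^'n^'n \<Rightarrow> real^'n \<Rightarrow> real" where
  "sqnormM M x = x \<bullet> (M *v x)"

definition sym_pos_def_mat :: "real^'n^'n \<Rightarrow> bool" where
  "sym_pos_def_mat G \<longleftrightarrow> transpose G = G \<and> (\<forall>x. x \<noteq> 0 \<longrightarrow> 0 < x \<bullet> (G *v x))"

definition mat_sqrt :: "real^'n^'n \<Rightarrow> real^'n^'n" where
  "mat_sqrt G = (THE S. transpose S = S \<and> (\<forall>x. 0 \<le> x \<bullet> (S *v x)) \<and> S ** S = G)"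

definition eigenvalues :: "real^'n^'n \<Rightarrow> real set" where
  "eigenvalues M = {c. \<exists>v. v \<noteq> 0 \<and> M *v v = c *\<^sub>R v}"

definition lambda_max :: "real^'n^'n \<Rightarrow> real" where
  "lambda_max M = Max (eigenvalues M)"

definition lambda_min :: "real^'n^'n \<Rightarrow> real" where
  "lambda_min M = Min (eigenvalues M)"

definition kappa :: "real^'n^'m \<Rightarrow> real^'n^'n \<Rightarrow> real" where
  "kappa A G = (let H = mat_sqrt G ** transpose A ** A ** mat_sqrt G
                in lambda_max H / lambda_min H)"

definition Tmat :: "real^'n^'m \<Rightarrow> real^'n^'n \<Rightarrow> real^'l^'m \<Rightarrow> real^'n^'n" where
  "Tmat A G Om = mat 1 - G ** transpose A ** Om **
      matrix_inv (transpose Om ** A ** G ** transpose A ** Om) ** transpose Om ** A"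

primrec Tprod :: "real^'n^'m \<Rightarrow> real^'n^'n \<Rightarrow> (nat \<Rightarrow> real^'l^'m) \<Rightarrow> nat \<Rightarrow> real^'n^'n" where
  "Tprod A G Om 0 = mat 1"
| "Tprod A G Om (Suc k) = Tmat A G (Om k) ** Tprod A G Om k"

primrec iter :: "real^'n^'m \<Rightarrow> real^'m \<Rightarrow> real^'n^'n \<Rightarrow> (nat \<Rightarrow> real^'l^'m) \<Rightarrow> real^'n \<Rightarrow> nat \<Rightarrow> real^'n" where
  "iter A b G Om x0 0 = x0"
| "iter A b G Om x0 (Suc k) = iter A b G Om x0 k +
     (G ** transpose A ** Om k ** matrix_inv (transpose (Om k) ** A ** G ** transpose A ** Om k)
        ** transpose (Om k)) *v (b - A *v iter A b G Om x0 k)"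

end

theory Submission
  imports Defs
begin

text \<open>Whenever the sketched Gram matrix $\Omega^T A G A^T \Omega$ is invertible, one step removes from
  the squared error the squared $G$-norm of a projection onto the range of $A^T \Omega$. Keeping only
  one column $\omega$ of $\Omega$, Cauchy-Schwarz shows that the loss is at least
  $(\omega^T A e)^2 / (\lambda_{max} |\omega|^2)$. The direction of a Gaussian vector is isotropic, so this
  has mean $|Ae|^2 / (m \lambda_{max})$, which is at least $\lambda_{min} / (m \lambda_{max})$ times the
  squared error; $\omega$ is independent of the current error, so the estimate integrates along the
  iteration. Invertibility holds almost surely because the determinant is a polynomial in the
  entries of $\Omega$ that does not vanish identically.\<close>

subsection \<open>Eigenvalues and square roots of symmetric matrices\<close>

text \<open>The full loss contains the inverse of a random Gram matrix, whose mean is hard to handle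
  directly. Testing the projection with one column replaces that inverse by a scalar quotient; the
  price is a rate that does not depend on the sketch size \<open>CARD('l)\<close>. The eigenvalues
  enter through the substitution \<open>e = mat_sqrt G *v z\<close>: the squared
  \<open>matrix_inv G\<close>-norm of \<open>e\<close> becomes \<open>z \<bullet> z\<close>, and the
  squared residual becomes the quadratic form of the matrix in \<open>kappa\<close>, so both
  spectral estimates are Rayleigh bounds. Since \<open>mat_sqrt\<close> is a definite description
  and the extreme eigenvalues are \<open>Max\<close> and \<open>Min\<close> of a set, existence and
  uniqueness of the root and finiteness of the spectrum have to come before any such bound.
  Expectations are integrals in \<open>ennreal\<close>: they make sense without integrability of the
  error, but negative values are truncated, hence the nonnegativity checks. As
  \<open>matrix_inv\<close> and division are total, measurability is shown everywhere, the decrease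
  only almost surely.\<close>

declare transpose_matrix_vector [simp del]

text \<open>First-order condition at a maximum, in algebraic form: for \<open>t = s * a\<close> with
  \<open>s * \<bar>c\<bar> < 1\<close> the quadratic term is too small to cancel the linear
  one.\<close>

lemma quadratic_nonpos_imp_linear_coeff_zero:
  fixes a c :: real
  assumes "\<And>t. 2 * t * a + t\<^sup>2 * c \<le> 0"
  shows "a = 0"
proof (rule ccontr)
  assume "a \<noteq> 0"
  define s where "s = 1 / (1 + \<bar>c\<bar>)"
  have s: "s > 0" "s * \<bar>c\<bar> < 1" by (auto simp: s_def field_simps)
  have "2 * (s * a) * a + (s * a)\<^sup>2 * c \<le> 0" by (rule assms)
  then have "s * a\<^sup>2 * (2 + s * c) \<le> 0" by (simp add: power2_eq_square algebra_simps)
  moreover have "s * c \<ge> s * (- \<bar>c\<bar>)" using s by (intro mult_left_mono) auto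
  then have "2 + s * c > 0" using s by simp
  ultimately show False using s \<open>a \<noteq> 0\<close> by (simp add: mult_le_0_iff)
qed

text \<open>The Rayleigh quotient attains its maximum on the compact unit sphere of
  \<open>U\<close>, and a maximiser is an eigenvector: \<open>f v - l *\<^sub>R v\<close> lies in
  \<open>U\<close> and is orthogonal to \<open>v\<close>, hence by stationarity to
  \<open>f v\<close>, hence to itself. Working in an invariant subspace prepares the induction on
  the dimension.\<close>

lemma selfadjoint_max_eigenvector:
  fixes f :: "'a::euclidean_space \<Rightarrow> 'a"
  assumes f: "linear f" and sa: "\<And>x y. f x \<bullet> y = x \<bullet> f y"
    and U: "subspace U" "\<And>x. x \<in> U \<Longrightarrow> f x \<in> U" and nt: "U \<noteq> {0}"
  obtains v where "v \<in> U" "norm v = 1" "f v = (v \<bullet> f v) *\<^sub>R v"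
proof -
  interpret linear f by fact
  let ?K = "sphere 0 1 \<inter> U"
  from nt obtain u where "u \<in> U" "u \<noteq> 0" using subspace_0[OF U(1)] by blast
  then have "(1 / norm u) *\<^sub>R u \<in> ?K" using U(1) by (simp add: subspace_scale)
  then have "?K \<noteq> {}" by blast
  moreover have "compact ?K" using closed_subspace[OF U(1)] by (intro compact_Int_closed) auto
  moreover have "continuous_on ?K (\<lambda>x. x \<bullet> f x)"
    using f by (intro continuous_intros linear_continuous_on) (simp add: linear_conv_bounded_linear)
  ultimately obtain v where v: "v \<in> ?K" and mx: "\<And>y. y \<in> ?K \<Longrightarrow> y \<bullet> f y \<le> v \<bullet> f v"
    using continuous_attains_sup[of ?K "\<lambda>x. x \<bullet> f x"] by blast
  define l where "l = v \<bullet> f v"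
  have vU: "v \<in> U" and vn: "norm v = 1" and vv: "v \<bullet> v = 1"
    using v by (auto simp: norm_eq_1)
  have bound: "y \<bullet> f y \<le> l * (y \<bullet> y)" if "y \<in> U" for y
  proof (cases "y = 0")
    case False
    then have "((1 / norm y) *\<^sub>R y) \<bullet> f ((1 / norm y) *\<^sub>R y) \<le> l"
      unfolding l_def using that U(1) by (intro mx) (simp add: subspace_scale)
    then show ?thesis using False
      by (simp add: scale field_simps power2_norm_eq_inner[symmetric] power2_eq_square)
  qed (simp add: zero)
  \<comment> \<open>\<open>bound\<close> is an equality at \<open>v\<close>, so along
    \<open>v + t *\<^sub>R w\<close> its defect is a quadratic in \<open>t\<close> without constant
    term and of constant sign; the linear coefficient is a multiple of
    \<open>w \<bullet> f v\<close>.\<close>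
  have orth: "w \<bullet> f v = 0" if w: "w \<in> U" "w \<bullet> v = 0" for w
  proof (rule quadratic_nonpos_imp_linear_coeff_zero)
    fix t :: real
    have "(v + t *\<^sub>R w) \<bullet> f (v + t *\<^sub>R w) \<le> l * ((v + t *\<^sub>R w) \<bullet> (v + t *\<^sub>R w))"
      using vU w U(1) by (intro bound subspace_add subspace_scale)
    moreover have "v \<bullet> f w = w \<bullet> f v" using sa[of v w] by (simp add: inner_commute)
    ultimately show "2 * t * (w \<bullet> f v) + t\<^sup>2 * (w \<bullet> f w - l * (w \<bullet> w)) \<le> 0"
      using w vv by (simp add: add scale inner_add_left inner_add_right l_def[symmetric]
          inner_commute[of v w] power2_eq_square algebra_simps)
  qed
  let ?w = "f v - l *\<^sub>R v"
  have wv: "?w \<bullet> v = 0" using vv by (simp add: inner_diff_left l_def inner_commute[of "f v"])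
  have "?w \<bullet> f v = 0" using vU U wv by (intro orth) (auto simp: subspace_diff subspace_scale)
  then have "?w \<bullet> ?w = 0" using wv by (simp add: inner_diff_right)
  then have "f v = l *\<^sub>R v" by simp
  then show ?thesis using that vU vn l_def by blast
qed

text \<open>Spectral theorem by induction on the dimension: split off one eigenvector
  \<open>v\<close>; self-adjointness makes the part of \<open>U\<close> orthogonal to
  \<open>v\<close> invariant again, and that part is strictly smaller.\<close>

lemma selfadjoint_eigenbasis_subspace:
  fixes f :: "'a::euclidean_space \<Rightarrow> 'a"
  assumes f: "linear f" and sa: "\<And>x y. f x \<bullet> y = x \<bullet> f y"
  shows "subspace U \<Longrightarrow> (\<And>x. x \<in> U \<Longrightarrow> f x \<in> U) \<Longrightarrow>
    \<exists>B. finite B \<and> pairwise orthogonal B \<and> (\<forall>b\<in>B. norm b = 1) \<and> span B = U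
      \<and> (\<forall>b\<in>B. f b = (b \<bullet> f b) *\<^sub>R b)"
proof (induction "dim U" arbitrary: U rule: less_induct)
  case less
  show ?case
  proof (cases "U = {0}")
    case True
    then show ?thesis by (intro exI[of _ "{}"]) auto
  next
    case False
    obtain v where v: "v \<in> U" "norm v = 1" "f v = (v \<bullet> f v) *\<^sub>R v"
      using selfadjoint_max_eigenvector[OF f sa less.prems(1) less.prems(2) False] by metis
    have vv: "v \<bullet> v = 1" using v by (simp add: norm_eq_1)
    let ?V = "U \<inter> {x. v \<bullet> x = 0}"
    have sV: "subspace ?V"
      using less.prems(1) subspace_hyperplane[of v] by (rule subspace_inter)
    have "v \<notin> ?V" using vv by simp
    then have "?V \<subset> U" using v(1) by blast
    then have "span ?V \<subset> span U" using sV less.prems(1) by (metis span_eq_iff)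
    then have "dim ?V < dim U" by (rule dim_psubset)
    moreover have "f x \<in> ?V" if "x \<in> ?V" for x
    proof -
      have "v \<bullet> f x = f v \<bullet> x" using sa by simp
      also have "\<dots> = (v \<bullet> f v) * (v \<bullet> x)" by (subst v(3)) simp
      finally show ?thesis using that less.prems(2) by auto
    qed
    ultimately obtain B where B: "finite B" "pairwise orthogonal B" "\<forall>b\<in>B. norm b = 1"
      "span B = ?V" "\<forall>b\<in>B. f b = (b \<bullet> f b) *\<^sub>R b"
      using less.hyps[OF _ sV] by blast
    have BV: "b \<in> ?V" if "b \<in> B" for b using B(4) span_base[OF that] by simp
    have "span (insert v B) = U"
    proof
      show "span (insert v B) \<subseteq> U"
        using v(1) BV less.prems(1) by (intro span_minimal) auto
      show "U \<subseteq> span (insert v B)"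
      proof
        fix x assume "x \<in> U"
        then have "x - (v \<bullet> x) *\<^sub>R v \<in> ?V"
          using v(1) less.prems(1) vv by (simp add: subspace_diff subspace_scale inner_diff_right)
        then show "x \<in> span (insert v B)" using B(4) by (auto simp: span_insert)
      qed
    qed
    moreover have "pairwise orthogonal (insert v B)"
      using B(2) BV by (auto simp: pairwise_insert orthogonal_def inner_commute)
    ultimately show ?thesis
      using B v by (intro exI[of _ "insert v B"]) auto
  qed
qed

text \<open>An orthonormal basis of eigenvectors. The eigenvalue of \<open>b\<close> is written
  \<open>b \<bullet> (S *v b)\<close>, so no separate family of eigenvalues has to be carried
  along.\<close>

definition eigenbasis :: "real^'n^'n \<Rightarrow> (real^'n) set \<Rightarrow> bool" where
  "eigenbasis S B \<longleftrightarrow> finite B \<and> pairwise orthogonal B \<and> (\<forall>b\<in>B. norm b = 1) \<and> span B = UNIV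
      \<and> (\<forall>b\<in>B. S *v b = (b \<bullet> (S *v b)) *\<^sub>R b)"

text \<open>This adjoint identity needs \<open>transpose A *v y\<close> to survive simplification,
  which is why the rule rewriting it to \<open>y v* A\<close> is removed from the simpset
  above.\<close>

lemma inner_matrix_vector_transpose:
  fixes A :: "real^'n^'m"
  shows "(A *v x) \<bullet> y = x \<bullet> (transpose A *v y)"
  by (metis dot_lmul_matrix transpose_matrix_vector transpose_transpose)

lemma symmetric_eigenbasis_exists:
  fixes S :: "real^'n^'n"
  assumes "transpose S = S"
  obtains B where "eigenbasis S B"
proof -
  have "\<And>x y. (S *v x) \<bullet> y = x \<bullet> (S *v y)"
    using inner_matrix_vector_transpose[of S] assms by simp
  from selfadjoint_eigenbasis_subspace[OF matrix_vector_mul_linear this subspace_UNIV]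
  show ?thesis using that unfolding eigenbasis_def by blast
qed

lemma eigenbasis_expand:
  assumes "eigenbasis S B"
  shows "(\<Sum>b\<in>B. (x \<bullet> b) *\<^sub>R b) = x"
  using assms by (intro orthonormal_basis_expand) (auto simp: eigenbasis_def)

lemma eigenbasis_parseval:
  assumes "eigenbasis S B"
  shows "(\<Sum>b\<in>B. (x \<bullet> b) * (y \<bullet> b)) = x \<bullet> y"
proof -
  have "x \<bullet> y = x \<bullet> (\<Sum>b\<in>B. (y \<bullet> b) *\<^sub>R b)" using eigenbasis_expand[OF assms] by simp
  then show ?thesis by (simp add: inner_sum_right mult.commute)
qed

lemma eigenbasis_quadratic_form:
  assumes "eigenbasis S B"
  shows "x \<bullet> (S *v x) = (\<Sum>b\<in>B. (b \<bullet> (S *v b)) * (x \<bullet> b)\<^sup>2)"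
proof -
  have "S *v x = S *v (\<Sum>b\<in>B. (x \<bullet> b) *\<^sub>R b)" using eigenbasis_expand[OF assms] by simp
  also have "\<dots> = (\<Sum>b\<in>B. (x \<bullet> b) *\<^sub>R (S *v b))"
    by (simp add: linear_sum[OF matrix_vector_mul_linear] matrix_vector_mult_scaleR)
  also have "\<dots> = (\<Sum>b\<in>B. (x \<bullet> b) *\<^sub>R (b \<bullet> (S *v b)) *\<^sub>R b)"
    using assms by (intro sum.cong) (auto simp: eigenbasis_def)
  finally show ?thesis by (simp add: inner_sum_right power2_eq_square mult_ac)
qed

text \<open>An eigenvector is not orthogonal to every basis vector, and by symmetry of
  \<open>S\<close> a nonzero coefficient along \<open>b\<close> forces its eigenvalue to be that of
  \<open>b\<close>. The spectrum is thus a finite image, which gives \<open>Max\<close> and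
  \<open>Min\<close> their meaning.\<close>

lemma eigenvalues_eigenbasis:
  assumes S: "transpose S = S" and B: "eigenbasis S B"
  shows "eigenvalues S = (\<lambda>b. b \<bullet> (S *v b)) ` B"
proof
  show "(\<lambda>b. b \<bullet> (S *v b)) ` B \<subseteq> eigenvalues S"
  proof clarify
    fix b assume "b \<in> B"
    then have "norm b = 1" "S *v b = (b \<bullet> (S *v b)) *\<^sub>R b" using B by (auto simp: eigenbasis_def)
    then show "b \<bullet> (S *v b) \<in> eigenvalues S"
      unfolding eigenvalues_def by (auto intro!: exI[of _ b])
  qed
  show "eigenvalues S \<subseteq> (\<lambda>b. b \<bullet> (S *v b)) ` B"
  proof
    fix c assume "c \<in> eigenvalues S"
    then obtain v where v: "v \<noteq> 0" "S *v v = c *\<^sub>R v" by (auto simp: eigenvalues_def)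
    obtain b where b: "b \<in> B" "v \<bullet> b \<noteq> 0"
    proof (rule ccontr)
      assume "\<not> thesis"
      then have "(\<Sum>b\<in>B. (v \<bullet> b) *\<^sub>R b) = 0" using that by (intro sum.neutral) auto
      then show False using eigenbasis_expand[OF B, of v] v(1) by simp
    qed
    have Sb: "S *v b = (b \<bullet> (S *v b)) *\<^sub>R b" using B b(1) by (simp add: eigenbasis_def)
    have "c * (v \<bullet> b) = (S *v v) \<bullet> b" using v by simp
    also have "\<dots> = v \<bullet> (S *v b)" using S by (simp add: inner_matrix_vector_transpose)
    also have "\<dots> = v \<bullet> ((b \<bullet> (S *v b)) *\<^sub>R b)" using Sb by (rule arg_cong)
    finally have "c = b \<bullet> (S *v b)" using b by simp
    then show "c \<in> (\<lambda>b. b \<bullet> (S *v b)) ` B" using b by blast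
  qed
qed

lemma symmetric_eigenvalues:
  fixes S :: "real^'n^'n"
  assumes S: "transpose S = S"
  shows "finite (eigenvalues S)" "eigenvalues S \<noteq> {}"
    "x \<bullet> (S *v x) \<le> lambda_max S * (x \<bullet> x)"
    "lambda_min S * (x \<bullet> x) \<le> x \<bullet> (S *v x)"
proof -
  obtain B where B: "eigenbasis S B" using symmetric_eigenbasis_exists[OF S] .
  note ev = eigenvalues_eigenbasis[OF S B]
  have fB: "finite B" using B by (simp add: eigenbasis_def)
  show fin: "finite (eigenvalues S)" using fB ev by simp
  have "B \<noteq> {}"
  proof
    assume "B = {}"
    then have "x = 0" for x :: "real^'n" using eigenbasis_expand[OF B, of x] by simp
    from this[of "axis undefined 1"] show False by (simp add: axis_eq_0_iff)
  qed
  then show "eigenvalues S \<noteq> {}" using ev by simp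
  have xx: "x \<bullet> x = (\<Sum>b\<in>B. (x \<bullet> b)\<^sup>2)"
    using eigenbasis_parseval[OF B, of x x] by (simp add: power2_eq_square)
  show "x \<bullet> (S *v x) \<le> lambda_max S * (x \<bullet> x)"
    unfolding eigenbasis_quadratic_form[OF B, of x] xx sum_distrib_left lambda_max_def
    using fin ev by (intro sum_mono mult_right_mono Max_ge) auto
  show "lambda_min S * (x \<bullet> x) \<le> x \<bullet> (S *v x)"
    unfolding eigenbasis_quadratic_form[OF B, of x] xx sum_distrib_left lambda_min_def
    using fin ev by (intro sum_mono mult_right_mono Min_le) auto
qed

section \<open>The square root of a positive definite matrix\<close>

lemma matrix_eqI_vector:
  fixes A B :: "real^'n^'m"
  assumes "\<And>x. A *v x = B *v x"
  shows "A = B"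
  using assms by (simp add: matrix_eq)

lemma eigenbasis_sqrt_apply:
  fixes R G :: "real^'n^'n"
  assumes G: "sym_pos_def_mat G" and B: "eigenbasis G B" and b: "b \<in> B"
    and R: "\<And>x. 0 \<le> x \<bullet> (R *v x)" "R ** R = G"
  shows "R *v b = sqrt (b \<bullet> (G *v b)) *\<^sub>R b"
proof -
  define s where "s = sqrt (b \<bullet> (G *v b))"
  have "norm b = 1" "G *v b = (b \<bullet> (G *v b)) *\<^sub>R b" using B b by (auto simp: eigenbasis_def)
  moreover from this have "b \<noteq> 0" by auto
  ultimately have s: "s > 0" and Gb: "G *v b = (s * s) *\<^sub>R b"
    using G by (auto simp: s_def sym_pos_def_mat_def less_imp_le)
  let ?y = "R *v b - s *\<^sub>R b"
  \<comment> \<open>With s = sqrt (b \<bullet> G b), (R + s)(R - s) b = (G - s * s) b = 0, and R + s is positive definite.\<close>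
  have "R *v ?y + s *\<^sub>R ?y = 0"
    using Gb R(2) by (simp add: matrix_vector_mult_diff_distrib matrix_vector_mult_scaleR
        matrix_vector_mul_assoc algebra_simps)
  then have "?y \<bullet> (R *v ?y) + s * (?y \<bullet> ?y) = 0"
    by (metis inner_add_right inner_scaleR_right inner_zero_right)
  then have "s * (?y \<bullet> ?y) \<le> 0" using R(1)[of ?y] by linarith
  then have "?y \<bullet> ?y \<le> 0" using s by (simp add: mult_le_0_iff)
  then have "?y = 0" by (metis inner_eq_zero_iff inner_ge_zero order_antisym)
  then show ?thesis by (simp add: s_def)
qed

text \<open>The description in \<open>mat_sqrt\<close> needs both halves. Existence: scale each
  vector of an eigenbasis of \<open>G\<close> by the root of its eigenvalue. Uniqueness:
  \<open>eigenbasis_sqrt_apply\<close> fixes any competing root on that same basis.\<close>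

lemma mat_sqrt_sym_pos_def:
  fixes G :: "real^'n^'n"
  assumes G: "sym_pos_def_mat G"
  shows "transpose (mat_sqrt G) = mat_sqrt G" "mat_sqrt G ** mat_sqrt G = G"
proof -
  have sG: "transpose G = G" using G by (simp add: sym_pos_def_mat_def)
  obtain B where B: "eigenbasis G B" using symmetric_eigenbasis_exists[OF sG] .
  define s where "s b = sqrt (b \<bullet> (G *v b))" for b
  have ss: "s b * s b = b \<bullet> (G *v b)" and s0: "0 \<le> s b" if "b \<in> B" for b
  proof -
    have "b \<bullet> (G *v b) \<ge> 0"
      using G by (cases "b = 0") (auto simp: sym_pos_def_mat_def less_imp_le)
    then show "s b * s b = b \<bullet> (G *v b)" "0 \<le> s b" by (auto simp: s_def)
  qed
  define f where "f x = (\<Sum>b\<in>B. s b *\<^sub>R (x \<bullet> b) *\<^sub>R b)" for x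
  have linf: "linear f"
    by (rule linearI) (simp_all add: f_def inner_add_left algebra_simps sum.distrib scaleR_sum_right)
  have saf: "f x \<bullet> y = x \<bullet> f y" for x y
    by (simp add: f_def inner_sum_left inner_sum_right inner_commute mult_ac)
  define R where "R = matrix f"
  have R: "R *v x = f x" for x using linf by (simp add: R_def matrix_works)
  have delta: "b \<bullet> c = (if b = c then 1 else 0)" if "b \<in> B" "c \<in> B" for b c
    using B that by (auto simp: eigenbasis_def pairwise_def orthogonal_def norm_eq_1)
  have fb: "f b = s b *\<^sub>R b" if "b \<in> B" for b
    using B that by (simp add: f_def delta if_distrib[of "\<lambda>c. c *\<^sub>R _"] if_distrib[of "\<lambda>c. _ *\<^sub>R c"]
        eigenbasis_def sum.delta cong: if_cong sum.cong)
  have "R ** R = G"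
  proof (rule matrix_eqI_vector)
    fix x
    have "(R ** R) *v x = f (f x)" by (simp add: R matrix_vector_mul_assoc[symmetric])
    also have "\<dots> = (\<Sum>b\<in>B. s b *\<^sub>R (x \<bullet> b) *\<^sub>R f b)"
      by (subst f_def[of x]) (simp add: linear_sum[OF linf] linear_scale[OF linf])
    also have "\<dots> = (\<Sum>b\<in>B. (x \<bullet> b) *\<^sub>R ((s b * s b) *\<^sub>R b))"
      by (intro sum.cong) (simp_all add: fb mult_ac)
    also have "\<dots> = (\<Sum>b\<in>B. (x \<bullet> b) *\<^sub>R (G *v b))"
      using B by (intro sum.cong) (simp_all add: ss eigenbasis_def)
    also have "\<dots> = G *v (\<Sum>b\<in>B. (x \<bullet> b) *\<^sub>R b)"
      by (simp add: linear_sum[OF matrix_vector_mul_linear] matrix_vector_mult_scaleR)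
    finally show "(R ** R) *v x = G *v x" using eigenbasis_expand[OF B] by simp
  qed
  moreover have "transpose R = R"
  proof (rule matrix_eqI_vector, rule vector_eq_rdot[THEN iffD1], rule allI)
    fix x y
    show "(transpose R *v x) \<bullet> y = (R *v x) \<bullet> y"
      by (metis R inner_commute inner_matrix_vector_transpose saf)
  qed
  moreover have "\<forall>x. 0 \<le> x \<bullet> (R *v x)"
    unfolding R by (auto simp: f_def inner_sum_right s0 mult.assoc intro!: sum_nonneg mult_nonneg_nonneg[OF s0])
  ultimately have P: "transpose R = R \<and> (\<forall>x. 0 \<le> x \<bullet> (R *v x)) \<and> R ** R = G" by blast
  have "mat_sqrt G = R" unfolding mat_sqrt_def
  proof (rule the_equality, rule P)
    fix S assume S: "transpose S = S \<and> (\<forall>x. 0 \<le> x \<bullet> (S *v x)) \<and> S ** S = G"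
    show "S = R"
    proof (rule matrix_eqI_vector)
      fix x
      have "S *v b = R *v b" if "b \<in> B" for b
        using eigenbasis_sqrt_apply[OF G B that] P S by metis
      then have "S *v (\<Sum>b\<in>B. (x \<bullet> b) *\<^sub>R b) = R *v (\<Sum>b\<in>B. (x \<bullet> b) *\<^sub>R b)"
        by (simp add: linear_sum[OF matrix_vector_mul_linear] matrix_vector_mult_scaleR)
      then show "S *v x = R *v x" using eigenbasis_expand[OF B] by simp
    qed
  qed
  then show "transpose (mat_sqrt G) = mat_sqrt G" "mat_sqrt G ** mat_sqrt G = G" using P by auto
qed


subsection \<open>One step of the iteration\<close>

lemma matrix_inv_right_left:
  fixes A :: "real^'n^'n"
  assumes "invertible A"
  shows "A ** matrix_inv A = mat 1" "matrix_inv A ** A = mat 1"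
  using someI_ex[OF assms[unfolded invertible_def]] by (simp_all add: matrix_inv_def)

lemma invertible_if_injective:
  fixes A :: "real^'n^'n"
  assumes "\<And>x. A *v x = 0 \<Longrightarrow> x = 0"
  shows "invertible A"
  using assms by (simp add: invertible_left_inverse matrix_left_invertible_ker)

lemma sym_pos_def_invertible: "sym_pos_def_mat G \<Longrightarrow> invertible G"
  unfolding sym_pos_def_mat_def by (rule invertible_if_injective) (metis inner_zero_right less_irrefl)

lemma mat_sqrt_quadratic_form:
  assumes "sym_pos_def_mat G"
  shows "(mat_sqrt G *v x) \<bullet> (mat_sqrt G *v y) = x \<bullet> (G *v y)"
  using mat_sqrt_sym_pos_def[OF assms]
  by (simp add: inner_matrix_vector_transpose matrix_vector_mul_assoc)

text \<open>With \<open>f = matrix_inv G *v x\<close>, the vector \<open>z = mat_sqrt G *v f\<close>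
  works. This change of variables to the Euclidean norm avoids introducing the inverse of the square
  root.\<close>

lemma sqnormM_inv_eq_inner:
  assumes G: "sym_pos_def_mat G"
  obtains z where "mat_sqrt G *v z = x" "sqnormM (matrix_inv G) x = z \<bullet> z"
proof
  define f where "f = matrix_inv G *v x"
  have x: "G *v f = x"
    using matrix_inv_right_left[OF sym_pos_def_invertible[OF G]]
    by (simp add: f_def matrix_vector_mul_assoc)
  show "mat_sqrt G *v (mat_sqrt G *v f) = x"
    using mat_sqrt_sym_pos_def[OF G] x by (simp add: matrix_vector_mul_assoc)
  show "sqnormM (matrix_inv G) x = (mat_sqrt G *v f) \<bullet> (mat_sqrt G *v f)"
    unfolding mat_sqrt_quadratic_form[OF G] x sqnormM_def by (simp add: f_def[symmetric] inner_commute)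
qed

lemma sqnormM_inv_nonneg: "sym_pos_def_mat G \<Longrightarrow> 0 \<le> sqnormM (matrix_inv G) x"
  by (metis sqnormM_inv_eq_inner inner_ge_zero)

text \<open>This is the matrix \<open>H\<close> inside \<open>kappa\<close>; its form at
  \<open>z\<close> is the squared residual of \<open>mat_sqrt G *v z\<close>.\<close>

abbreviation precond_gram :: "real^'n^'m \<Rightarrow> real^'n^'n \<Rightarrow> real^'n^'n" where
  "precond_gram A G \<equiv> mat_sqrt G ** transpose A ** A ** mat_sqrt G"

lemma precond_gram_quadratic_form:
  assumes "sym_pos_def_mat G"
  shows "x \<bullet> (precond_gram A G *v x) = (A *v (mat_sqrt G *v x)) \<bullet> (A *v (mat_sqrt G *v x))"
  using mat_sqrt_sym_pos_def[OF assms]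
  by (simp add: inner_matrix_vector_transpose matrix_vector_mul_assoc[symmetric])

lemma precond_gram_symmetric:
  assumes "sym_pos_def_mat G"
  shows "transpose (precond_gram A G) = precond_gram A G"
  using mat_sqrt_sym_pos_def[OF assms] by (simp add: matrix_transpose_mul matrix_mul_assoc)

lemmas precond_gram_eigenvalues = symmetric_eigenvalues[OF precond_gram_symmetric]

text \<open>Evaluate the form at an eigenvector for the smallest eigenvalue: \<open>A\<close> and
  \<open>mat_sqrt G\<close> are both injective, so the value is positive. Hence the quotient in
  \<open>kappa\<close> has a positive denominator.\<close>

lemma precond_gram_lambda:
  assumes G: "sym_pos_def_mat G" and A: "inj ((*v) A)"
  shows "0 < lambda_min (precond_gram A G)"
    "lambda_min (precond_gram A G) \<le> lambda_max (precond_gram A G)"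
proof -
  let ?H = "precond_gram A G"
  note ev = precond_gram_eigenvalues[OF G, where A = A]
  have "lambda_min ?H \<in> eigenvalues ?H" unfolding lambda_min_def using ev(1,2) by (rule Min_in)
  then obtain v where v: "v \<noteq> 0" "?H *v v = lambda_min ?H *\<^sub>R v" by (auto simp: eigenvalues_def)
  have "A *v (mat_sqrt G *v v) \<noteq> 0"
  proof
    assume "A *v (mat_sqrt G *v v) = 0"
    then have "mat_sqrt G *v v = 0" using A by (metis injD matrix_vector_mult_0_right)
    then have "v \<bullet> (G *v v) = 0" using mat_sqrt_quadratic_form[OF G, of v v] by simp
    then show False using v(1) G by (auto simp: sym_pos_def_mat_def)
  qed
  then have "0 < v \<bullet> (?H *v v)" by (simp add: precond_gram_quadratic_form[OF G])
  then have "0 < lambda_min ?H * (v \<bullet> v)" using v by simp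
  then show "0 < lambda_min ?H" using inner_ge_zero[of v] by (simp add: zero_less_mult_iff)
  show "lambda_min ?H \<le> lambda_max ?H"
    unfolding lambda_max_def lambda_min_def using ev(1,2) by (meson Max_ge Min_in)
qed

lemma kappa_ge_1:
  assumes "sym_pos_def_mat G" "inj ((*v) A)"
  shows "1 \<le> kappa A G"
  using precond_gram_lambda[OF assms] by (simp add: kappa_def Let_def)

lemma residual_le_lambda_max:
  assumes "sym_pos_def_mat G"
  shows "(A *v e) \<bullet> (A *v e) \<le> lambda_max (precond_gram A G) * sqnormM (matrix_inv G) e"
  by (metis assms sqnormM_inv_eq_inner precond_gram_quadratic_form precond_gram_eigenvalues(3))

lemma residual_ge_lambda_min:
  assumes "sym_pos_def_mat G"
  shows "lambda_min (precond_gram A G) * sqnormM (matrix_inv G) e \<le> (A *v e) \<bullet> (A *v e)"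
  by (metis assms sqnormM_inv_eq_inner precond_gram_quadratic_form precond_gram_eigenvalues(4))

text \<open>\<open>A ** G ** transpose A\<close> and \<open>precond_gram A G\<close> are the two
  products of one factor with its transpose, so the same top eigenvalue bounds both. Put
  \<open>p = mat_sqrt G *v (transpose A *v w)\<close>; then
  \<open>p \<bullet> p = (A *v (mat_sqrt G *v p)) \<bullet> w\<close>, and after Cauchy-Schwarz and
  the Rayleigh bound a factor \<open>p \<bullet> p\<close> cancels.\<close>

lemma transposed_quadratic_form_le_lambda_max:
  fixes A :: "real^'n^'m"
  assumes G: "sym_pos_def_mat G" and A: "inj ((*v) A)"
  shows "(transpose A *v w) \<bullet> (G *v (transpose A *v w)) \<le> lambda_max (precond_gram A G) * (w \<bullet> w)"
proof -
  let ?L = "lambda_max (precond_gram A G)"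
  define p where "p = mat_sqrt G *v (transpose A *v w)"
  have p: "(transpose A *v w) \<bullet> (G *v (transpose A *v w)) = p \<bullet> p"
    unfolding p_def mat_sqrt_quadratic_form[OF G] ..
  have "p \<bullet> p = (A *v (mat_sqrt G *v p)) \<bullet> w"
    using mat_sqrt_sym_pos_def[OF G]
    by (simp add: inner_matrix_vector_transpose p_def)
  then have "(p \<bullet> p)\<^sup>2 \<le> (A *v (mat_sqrt G *v p)) \<bullet> (A *v (mat_sqrt G *v p)) * (w \<bullet> w)"
    by (metis Cauchy_Schwarz_ineq)
  also have "\<dots> \<le> (?L * (p \<bullet> p)) * (w \<bullet> w)"
    using precond_gram_eigenvalues(3)[OF G, where x = p and A = A]
    by (intro mult_right_mono) (auto simp: precond_gram_quadratic_form[OF G])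
  finally have "(p \<bullet> p) * (p \<bullet> p) \<le> (p \<bullet> p) * (?L * (w \<bullet> w))"
    by (simp add: power2_eq_square mult_ac)
  moreover have "0 \<le> ?L * (w \<bullet> w)" using precond_gram_lambda[OF G A] by simp
  ultimately show ?thesis unfolding p using inner_ge_zero[of p]
    by (cases "p \<bullet> p = 0") (auto simp: mult_le_cancel_left)
qed

abbreviation sketch_gram :: "real^'n^'m \<Rightarrow> real^'n^'n \<Rightarrow> real^'l^'m \<Rightarrow> real^'l^'l" where
  "sketch_gram A G W \<equiv> transpose W ** A ** G ** transpose A ** W"

lemma sketch_gram_quadratic_form:
  "x \<bullet> (sketch_gram A G W *v y) = (transpose A *v (W *v x)) \<bullet> (G *v (transpose A *v (W *v y)))"
  by (simp add: inner_matrix_vector_transpose matrix_vector_mul_assoc[symmetric])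

lemma sketch_step_sqnorm_le:
  fixes A :: "real^'n^'m" and W :: "real^'l^'m"
  assumes G: "sym_pos_def_mat G" and A: "inj ((*v) A)" and B: "invertible (sketch_gram A G W)"
  shows "sqnormM (matrix_inv G) (Tmat A G W *v e)
    \<le> sqnormM (matrix_inv G) e
      - (column c W \<bullet> (A *v e))\<^sup>2 / (lambda_max (precond_gram A G) * (column c W \<bullet> column c W))"
proof -
  let ?L = "lambda_max (precond_gram A G)"
  let ?B = "sketch_gram A G W"
  let ?Gi = "matrix_inv G"
  let ?w = "column c W"
  \<comment> \<open>\<open>u\<close> solves the sketched normal equations \<open>Bu\<close>; the
    update subtracts \<open>G *v d\<close>.\<close>
  define u where "u = matrix_inv ?B *v (transpose W *v (A *v e))"
  define d where "d = transpose A *v (W *v u)"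
  note Gi = matrix_inv_right_left[OF sym_pos_def_invertible[OF G]]
  have symG: "transpose G = G" using G by (simp add: sym_pos_def_mat_def)
  have Bu: "?B *v u = transpose W *v (A *v e)"
    unfolding u_def matrix_vector_mul_assoc[of ?B] matrix_inv_right_left[OF B] by simp
  have Gie: "(G *v d) \<bullet> (?Gi *v y) = d \<bullet> y" for y
    using Gi(1) symG by (simp add: inner_matrix_vector_transpose matrix_vector_mul_assoc)
  have Ginv: "?Gi *v (G *v d) = d"
    using Gi(2) by (simp add: matrix_vector_mul_assoc)
  have Te: "Tmat A G W *v e = e - G *v d"
    by (simp add: Tmat_def d_def u_def matrix_vector_mult_diff_rdistrib matrix_vector_mul_assoc[symmetric])
  have de: "d \<bullet> e = u \<bullet> (?B *v u)"
    unfolding Bu by (simp add: d_def inner_matrix_vector_transpose)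
  have dd: "d \<bullet> (G *v d) = u \<bullet> (?B *v u)"
    unfolding sketch_gram_quadratic_form d_def ..
  \<comment> \<open>The square expands with cross term \<open>-2 * (d \<bullet> e)\<close> and
    quadratic term \<open>d \<bullet> (G *v d)\<close>; both inner products equal
    \<open>u \<bullet> (?B *v u)\<close>, so exactly one copy is lost.\<close>
  have loss: "sqnormM ?Gi (Tmat A G W *v e) = sqnormM ?Gi e - u \<bullet> (?B *v u)"
    unfolding sqnormM_def Te
    using de dd by (simp add: matrix_vector_mult_diff_distrib Ginv inner_diff_left inner_diff_right Gie
        inner_commute[of e d] inner_commute[of "G *v d" d])
  have Wc: "W *v axis c 1 = ?w" by (simp add: matrix_vector_mult_basis)
  \<comment> \<open>Reading off coordinate \<open>c\<close> of the normal equations turns the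
    sampled residual into an inner product with the projection, ready for Cauchy-Schwarz.\<close>
  have "?w \<bullet> (A *v e) = axis c 1 \<bullet> (?B *v u)"
    unfolding Bu Wc[symmetric] by (simp add: inner_matrix_vector_transpose)
  also have "\<dots> = (mat_sqrt G *v (transpose A *v ?w)) \<bullet> (mat_sqrt G *v d)"
    unfolding mat_sqrt_quadratic_form[OF G] sketch_gram_quadratic_form d_def Wc ..
  finally have "(?w \<bullet> (A *v e))\<^sup>2
      \<le> ((transpose A *v ?w) \<bullet> (G *v (transpose A *v ?w))) * (u \<bullet> (?B *v u))"
    using Cauchy_Schwarz_ineq[of "mat_sqrt G *v (transpose A *v ?w)" "mat_sqrt G *v d"]
    unfolding mat_sqrt_quadratic_form[OF G] dd by simp
  also have "\<dots> \<le> (?L * (?w \<bullet> ?w)) * (u \<bullet> (?B *v u))"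
  proof (rule mult_right_mono[OF transposed_quadratic_form_le_lambda_max[OF G A]])
    show "0 \<le> u \<bullet> (?B *v u)" unfolding dd[symmetric] mat_sqrt_quadratic_form[OF G, symmetric] by simp
  qed
  finally have le: "(?w \<bullet> (A *v e))\<^sup>2 \<le> (?L * (?w \<bullet> ?w)) * (u \<bullet> (?B *v u))" .
  have "(?w \<bullet> (A *v e))\<^sup>2 / (?L * (?w \<bullet> ?w)) \<le> u \<bullet> (?B *v u)"
  \<comment> \<open>For a zero column the quotient is \<open>0\<close> by the convention for
    division, and the loss is still nonnegative.\<close>
  proof (cases "?w = 0")
    case True
    then show ?thesis
      unfolding dd[symmetric] mat_sqrt_quadratic_form[OF G, symmetric] by simp
  next
    case False
    then have "?L * (?w \<bullet> ?w) > 0" using precond_gram_lambda[OF G A] by simp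
    then show ?thesis using le by (simp add: pos_divide_le_eq mult_ac)
  qed
  then show ?thesis unfolding loss by simp
qed

text \<open>A left inverse \<open>L\<close> of \<open>A\<close> lets \<open>transpose A ** W\<close>
  be prescribed: it becomes the injective coordinate embedding \<open>J\<close>, and the form of
  \<open>G\<close> along an injective map is definite. The witness shows that the determinant
  polynomial is not identically zero.\<close>

lemma exists_invertible_sketch_gram:
  fixes A :: "real^'n^'m"
  assumes G: "sym_pos_def_mat G" and A: "inj ((*v) A)" and l: "CARD('l) \<le> CARD('n)"
  shows "\<exists>W :: real^'l^'m. invertible (sketch_gram A G W)"
proof -
  obtain L where L: "L ** A = mat 1" using A by (auto simp: matrix_left_invertible_injective[symmetric])
  obtain \<iota> :: "'l \<Rightarrow> 'n" where \<iota>: "inj \<iota>"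
    using l by (metis card_le_inj finite_class.finite_UNIV inj_on_def)
  define J :: "real^'l^'n" where "J = (\<chi> i j. if i = \<iota> j then 1 else 0)"
  have J: "(J *v x) $ \<iota> j = x $ j" for x j
    using \<iota> by (simp add: J_def matrix_vector_mult_def inj_eq if_distrib[of "\<lambda>c. c * _"] cong: if_cong)
  define W where "W = transpose L ** J"
  have "transpose A ** transpose L = mat 1"
    using arg_cong[OF L, of transpose] by (simp add: matrix_transpose_mul transpose_mat)
  then have AW: "transpose A *v (W *v x) = J *v x" for x
    by (simp add: W_def matrix_vector_mul_assoc matrix_mul_assoc)
  have "invertible (sketch_gram A G W)"
  proof (rule invertible_if_injective)
    fix x assume "sketch_gram A G W *v x = 0"
    then have "(J *v x) \<bullet> (G *v (J *v x)) = 0"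
      using sketch_gram_quadratic_form[where G = G and x = x and y = x and A = A and W = W] by (simp add: AW)
    then have "J *v x = 0" using G by (auto simp: sym_pos_def_mat_def)
    then show "x = 0" using J by (simp add: vec_eq_iff) (metis J zero_index)
  qed
  then show ?thesis by blast
qed

lemma iter_error_eq:
  assumes "A *v xstar = b"
  shows "iter A b G W x0 k - xstar = Tprod A G W k *v (x0 - xstar)"
proof (induction k)
  case (Suc k)
  define v where "v = Tprod A G W k *v (x0 - xstar)"
  have "iter A b G W x0 k = xstar + v" using Suc by (simp add: v_def algebra_simps)
  then have "b - A *v iter A b G W x0 k = - (A *v v)"
    using assms by (simp add: matrix_vector_right_distrib)
  moreover have "Tprod A G W (Suc k) *v (x0 - xstar) = Tmat A G (W k) *v v"
    by (simp add: v_def matrix_vector_mul_assoc)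
  ultimately show ?case
    using \<open>iter A b G W x0 k = xstar + v\<close>
    by (simp add: Tmat_def matrix_vector_mult_diff_rdistrib matrix_vector_mul_assoc
        linear_neg[OF matrix_vector_mul_linear])
qed simp

subsection \<open>Families of independent standard normal variables\<close>

text \<open>Injectivity makes the blocks \<open>{f j}\<close> disjoint, so this is grouping of
  independent variables into singleton blocks.\<close>

lemma (in prob_space) indep_vars_reindex:
  assumes X: "indep_vars (\<lambda>_. N) X I" and f: "inj_on f J" "f ` J \<subseteq> I"
  shows "indep_vars (\<lambda>_. N) (\<lambda>j. X (f j)) J"
proof -
  have "indep_vars (\<lambda>j. PiM {f j} (\<lambda>_. N)) (\<lambda>j \<omega>. restrict (\<lambda>i. X i \<omega>) {f j}) J"
    using f by (intro indep_vars_restrict[OF X]) (auto simp: disjoint_family_on_def inj_on_def)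
  then have "indep_vars (\<lambda>_. N) (\<lambda>j \<omega>. (restrict (\<lambda>i. X i \<omega>) {f j}) (f j)) J"
    by (rule indep_vars_compose2[where Y = "\<lambda>j x. x (f j)"]) (auto intro: measurable_component_singleton)
  then show ?thesis by simp
qed

abbreviation std_normal :: "real measure" where
  "std_normal \<equiv> density lborel (\<lambda>x. ennreal (std_normal_density x))"

lemma prob_space_std_normal: "prob_space std_normal"
  by (rule prob_space_normal_density) simp

lemma AE_std_normal_finite:
  assumes "finite A"
  shows "AE x in std_normal. x \<notin> A"
proof -
  have "AE x in lborel. x \<notin> A" using finite_imp_null_set_lborel[OF assms] by (rule AE_not_in)
  then show ?thesis by (auto simp: AE_density)
qed

text \<open>The index type is arbitrary, so the whole sequence of sketches, one sketch and one
  column are all instances, connected by \<open>std_normal_family_reindex\<close>.\<close>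

definition (in prob_space) std_normal_family :: "('i \<Rightarrow> 'a \<Rightarrow> real) \<Rightarrow> bool" where
  "std_normal_family X \<longleftrightarrow> indep_vars (\<lambda>_. borel) X UNIV
    \<and> (\<forall>i. distributed M lborel (X i) (\<lambda>x. ennreal (std_normal_density x)))"

context prob_space
begin

lemma std_normal_family_measurable:
  assumes "std_normal_family X"
  shows "X i \<in> borel_measurable M"
  using assms distributed_measurable unfolding std_normal_family_def by fastforce

lemma std_normal_family_reindex:
  "std_normal_family X \<Longrightarrow> inj f \<Longrightarrow> std_normal_family (\<lambda>j. X (f j))"
  unfolding std_normal_family_def by (auto intro: indep_vars_reindex)

lemma std_normal_family_distr:
  assumes X: "std_normal_family X"
  shows "distr M (\<Pi>\<^sub>M i\<in>UNIV. borel) (\<lambda>\<omega> i. X i \<omega>) = (\<Pi>\<^sub>M i\<in>UNIV. std_normal)"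
proof -
  have "distr M borel (X i) = std_normal" for i
  proof -
    have "distr M borel (X i) = distr M lborel (X i)" by (rule distr_cong) simp_all
    then show ?thesis using X by (simp add: std_normal_family_def distributed_def)
  qed
  moreover have "distr M (\<Pi>\<^sub>M i\<in>UNIV. borel) (\<lambda>x. \<lambda>i\<in>UNIV. X i x) = (\<Pi>\<^sub>M i\<in>UNIV. distr M borel (X i))"
    using X std_normal_family_measurable[OF X]
    by (subst indep_vars_iff_distr_eq_PiM[symmetric]) (auto simp: std_normal_family_def)
  ultimately show ?thesis by (simp add: restrict_def)
qed

text \<open>The right-hand side does not mention \<open>X\<close>: two families over the same index
  type give equal expectations. Every symmetry argument below rests on this.\<close>

lemma std_normal_family_expectation:
  fixes h :: "('i \<Rightarrow> real) \<Rightarrow> real"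
  assumes X: "std_normal_family X" and h: "h \<in> borel_measurable (\<Pi>\<^sub>M i\<in>UNIV. borel)"
  shows "expectation (\<lambda>\<omega>. h (\<lambda>i. X i \<omega>)) = (\<integral>x. h x \<partial>(\<Pi>\<^sub>M i\<in>UNIV. std_normal))"
  unfolding std_normal_family_distr[OF X, symmetric]
  using std_normal_family_measurable[OF X]
  by (subst integral_distr[OF _ h]) (auto intro!: measurable_PiM_single')

lemma std_normal_family_AE:
  assumes X: "std_normal_family X" and h: "Measurable.pred (\<Pi>\<^sub>M i\<in>UNIV. borel) P"
    and P: "AE x in (\<Pi>\<^sub>M i\<in>UNIV. std_normal). P x"
  shows "AE \<omega> in M. P (\<lambda>i. X i \<omega>)"
proof -
  have "(\<lambda>\<omega> i. X i \<omega>) \<in> measurable M (\<Pi>\<^sub>M i\<in>UNIV. borel)"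
    using std_normal_family_measurable[OF X] by (auto intro!: measurable_PiM_single')
  then show ?thesis
    using P h unfolding std_normal_family_distr[OF X, symmetric] by (subst (asm) AE_distr_iff) auto
qed

lemma std_normal_family_negate:
  assumes X: "std_normal_family X"
  shows "std_normal_family (\<lambda>j \<omega>. if j = i then - X j \<omega> else X j \<omega>)"
proof -
  have "indep_vars (\<lambda>_. borel) (\<lambda>j \<omega>. (if j = i then uminus else id) (X j \<omega>)) UNIV"
  proof (rule indep_vars_compose2[where Y = "\<lambda>j. if j = i then uminus else id"])
    show "indep_vars (\<lambda>_. borel) X UNIV" using X by (simp add: std_normal_family_def)
    show "(if j = i then uminus else id) \<in> borel_measurable (borel :: real measure)" for j
      by (cases "j = i") (simp_all add: id_def borel_measurable_uminus)
  qed
  moreover have "(\<lambda>j \<omega>. (if j = i then uminus else id) (X j \<omega>)) = (\<lambda>j \<omega>. if j = i then - X j \<omega> else X j \<omega>)"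
    by auto
  moreover have "distributed M lborel (\<lambda>\<omega>. - X j \<omega>) (\<lambda>x. ennreal (std_normal_density x))" for j
    using normal_density_affine[of "X j" 0 1 "-1" 0] X by (simp add: std_normal_family_def)
  then have "distributed M lborel (\<lambda>\<omega>. if j = i then - X j \<omega> else X j \<omega>)
      (\<lambda>x. ennreal (std_normal_density x))" for j
    using X by (cases "j = i") (simp_all add: std_normal_family_def)
  ultimately show ?thesis by (simp add: std_normal_family_def)
qed

section \<open>Second moments of the direction of a Gaussian vector\<close>

lemma std_normal_family_neq_0:
  assumes X: "std_normal_family X"
  shows "AE \<omega> in M. X i \<omega> \<noteq> 0"
proof -
  have "AE x in std_normal. x \<noteq> 0" using AE_std_normal_finite[of "{0}"] by simp
  then have "AE x in distr M lborel (X i). x \<noteq> 0"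
    using X distributed_distr_eq_density unfolding std_normal_family_def by metis
  then show ?thesis
    using std_normal_family_measurable[OF X, of i] by (subst (asm) AE_distr_iff) auto
qed

lemma direction_product_bounded:
  fixes X :: "'i::finite \<Rightarrow> 'a \<Rightarrow> real"
  shows "\<bar>X i \<omega> * X j \<omega> / (\<Sum>k\<in>UNIV. (X k \<omega>)\<^sup>2)\<bar> \<le> 1"
proof -
  let ?S = "\<Sum>k\<in>UNIV. (X k \<omega>)\<^sup>2"
  have S: "(X k \<omega>)\<^sup>2 \<le> ?S" for k by (rule member_le_sum) auto
  have "2 * \<bar>X i \<omega> * X j \<omega>\<bar> \<le> (X i \<omega>)\<^sup>2 + (X j \<omega>)\<^sup>2"
    using sum_squares_bound[of "\<bar>X i \<omega>\<bar>" "\<bar>X j \<omega>\<bar>"] by (simp add: abs_mult)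
  then have "\<bar>X i \<omega> * X j \<omega>\<bar> \<le> ?S" using S[of i] S[of j] by linarith
  moreover have "0 \<le> ?S" by (simp add: sum_nonneg)
  ultimately show ?thesis by (cases "?S = 0") (simp_all add: divide_le_eq_1 abs_divide)
qed

lemma std_normal_family_direction_integrable:
  fixes X :: "'i::finite \<Rightarrow> 'a \<Rightarrow> real"
  assumes X: "std_normal_family X"
  shows "integrable M (\<lambda>\<omega>. X i \<omega> * X j \<omega> / (\<Sum>k\<in>UNIV. (X k \<omega>)\<^sup>2))"
  using std_normal_family_measurable[OF X] direction_product_bounded[of X i _ j]
  by (intro integrable_const_bound[where B = 1]) auto

text \<open>The law of the family is invariant under sign changes and permutations of the coordinates:
  the former kills the off-diagonal second moments of the direction, the latter equates
  the diagonal ones, which add up to 1.\<close>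

lemma std_normal_family_direction_moment:
  fixes X :: "'i::finite \<Rightarrow> 'a \<Rightarrow> real"
  assumes X: "std_normal_family X"
  shows "expectation (\<lambda>\<omega>. X i \<omega> * X j \<omega> / (\<Sum>k\<in>UNIV. (X k \<omega>)\<^sup>2)) = (if i = j then 1 / real CARD('i) else 0)"
proof (cases "i = j")
  case False
  let ?Y = "\<lambda>j \<omega>. if j = i then - X j \<omega> else X j \<omega>"
  let ?h = "\<lambda>x :: 'i \<Rightarrow> real. x i * x j / (\<Sum>k\<in>UNIV. (x k)\<^sup>2)"
  have h: "?h \<in> borel_measurable (\<Pi>\<^sub>M i\<in>UNIV. borel)" by measurable
  have "expectation (\<lambda>\<omega>. ?h (\<lambda>j. X j \<omega>)) = expectation (\<lambda>\<omega>. ?h (\<lambda>j. ?Y j \<omega>))"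
    unfolding std_normal_family_expectation[OF X h]
      std_normal_family_expectation[OF std_normal_family_negate[OF X] h] ..
  also have "(\<lambda>\<omega>. ?h (\<lambda>j. ?Y j \<omega>)) = (\<lambda>\<omega>. - ?h (\<lambda>j. X j \<omega>))"
  proof
    fix \<omega>
    have "(\<Sum>k\<in>UNIV. (?Y k \<omega>)\<^sup>2) = (\<Sum>k\<in>UNIV. (X k \<omega>)\<^sup>2)" by (rule sum.cong) auto
    then show "?h (\<lambda>j. ?Y j \<omega>) = - ?h (\<lambda>j. X j \<omega>)" using False by simp
  qed
  finally show ?thesis using False by simp
next
  case True
  define E where "E k = expectation (\<lambda>\<omega>. X k \<omega> * X k \<omega> / (\<Sum>k\<in>UNIV. (X k \<omega>)\<^sup>2))" for k
  have "E k = E i" for k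
  proof -
    let ?h = "\<lambda>x :: 'i \<Rightarrow> real. x i * x i / (\<Sum>k\<in>UNIV. (x k)\<^sup>2)"
    have h: "?h \<in> borel_measurable (\<Pi>\<^sub>M i\<in>UNIV. borel)" by measurable
    have "E i = expectation (\<lambda>\<omega>. ?h (\<lambda>j. X j \<omega>))" by (simp add: E_def)
    also have "\<dots> = expectation (\<lambda>\<omega>. ?h (\<lambda>j. X (Transposition.transpose i k j) \<omega>))"
      unfolding std_normal_family_expectation[OF X h]
        std_normal_family_expectation[OF std_normal_family_reindex[OF X inj_transpose] h] ..
    also have "\<dots> = E k"
    proof -
      have "(\<Sum>j\<in>UNIV. (X (Transposition.transpose i k j) \<omega>)\<^sup>2) = (\<Sum>j\<in>UNIV. (X j \<omega>)\<^sup>2)" for \<omega>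
        by (rule sum.reindex_bij_betw) (simp add: bij_transpose)
      then show ?thesis by (simp add: E_def)
    qed
    finally show ?thesis by simp
  qed
  then have "(\<Sum>k\<in>UNIV. E k) = (\<Sum>k\<in>(UNIV :: 'i set). E i)" by (intro sum.cong) auto
  then have "real CARD('i) * E i = (\<Sum>k\<in>UNIV. E k)" by simp
  also have "\<dots> = expectation (\<lambda>\<omega>. \<Sum>k\<in>UNIV. X k \<omega> * X k \<omega> / (\<Sum>k\<in>UNIV. (X k \<omega>)\<^sup>2))"
    unfolding E_def
    using std_normal_family_direction_integrable[OF X] by (intro Bochner_Integration.integral_sum[symmetric])
  also have "\<dots> = expectation (\<lambda>\<omega>. 1)"
  proof (rule integral_cong_AE)
    \<comment> \<open>Only almost surely: at the zero vector every quotient is \<open>0\<close>, so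
      the sum would be \<open>0\<close> instead of \<open>1\<close>.\<close>
    show "AE \<omega> in M. (\<Sum>k\<in>UNIV. X k \<omega> * X k \<omega> / (\<Sum>k\<in>UNIV. (X k \<omega>)\<^sup>2)) = 1"
      using std_normal_family_neq_0[OF X, of i]
    proof eventually_elim
      case (elim \<omega>)
      then have "0 < (\<Sum>k\<in>UNIV. (X k \<omega>)\<^sup>2)" by (intro sum_pos2[of _ i]) auto
      then show ?case by (simp add: sum_divide_distrib[symmetric] power2_eq_square)
    qed
  qed (use std_normal_family_measurable[OF X] in measurable)
  finally have "E i = 1 / real CARD('i)" by (simp add: prob_space field_simps)
  then show ?thesis using True by (simp add: E_def)
qed

text \<open>The second moment matrix of \<open>V / norm V\<close> is the identity divided by
  \<open>CARD('m)\<close>; the claim is its quadratic form at \<open>r\<close>, expanded in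
  coordinates.\<close>

lemma std_normal_vector_direction_moment:
  fixes V :: "'a \<Rightarrow> real^'m" and r :: "real^'m"
  assumes V: "std_normal_family (\<lambda>i \<omega>. V \<omega> $ i)"
  shows "integrable M (\<lambda>\<omega>. (V \<omega> \<bullet> r)\<^sup>2 / (V \<omega> \<bullet> V \<omega>))"
    "expectation (\<lambda>\<omega>. (V \<omega> \<bullet> r)\<^sup>2 / (V \<omega> \<bullet> V \<omega>)) = (r \<bullet> r) / real CARD('m)"
proof -
  let ?D = "\<lambda>i j \<omega>. V \<omega> $ i * V \<omega> $ j / (\<Sum>k\<in>UNIV. (V \<omega> $ k)\<^sup>2)"
  have eq: "(\<lambda>\<omega>. (V \<omega> \<bullet> r)\<^sup>2 / (V \<omega> \<bullet> V \<omega>)) = (\<lambda>\<omega>. \<Sum>i\<in>UNIV. \<Sum>j\<in>UNIV. r $ i * r $ j * ?D i j \<omega>)"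
  proof
    fix \<omega>
    have "(V \<omega> \<bullet> r)\<^sup>2 = (\<Sum>i\<in>UNIV. \<Sum>j\<in>UNIV. r $ i * r $ j * (V \<omega> $ i * V \<omega> $ j))"
      by (simp add: inner_vec_def power2_eq_square sum_product mult_ac)
    moreover have "V \<omega> \<bullet> V \<omega> = (\<Sum>k\<in>UNIV. (V \<omega> $ k)\<^sup>2)"
      by (simp add: inner_vec_def power2_eq_square)
    ultimately show "(V \<omega> \<bullet> r)\<^sup>2 / (V \<omega> \<bullet> V \<omega>) = (\<Sum>i\<in>UNIV. \<Sum>j\<in>UNIV. r $ i * r $ j * ?D i j \<omega>)"
      by (simp add: sum_divide_distrib)
  qed
  have int: "integrable M (\<lambda>\<omega>. r $ i * r $ j * ?D i j \<omega>)" for i j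
    by (intro integrable_mult_right std_normal_family_direction_integrable[OF V])
  show "integrable M (\<lambda>\<omega>. (V \<omega> \<bullet> r)\<^sup>2 / (V \<omega> \<bullet> V \<omega>))"
    unfolding eq by (intro Bochner_Integration.integrable_sum int)
  have "expectation (\<lambda>\<omega>. (V \<omega> \<bullet> r)\<^sup>2 / (V \<omega> \<bullet> V \<omega>))
    = (\<Sum>i\<in>UNIV. \<Sum>j\<in>UNIV. expectation (\<lambda>\<omega>. r $ i * r $ j * ?D i j \<omega>))"
    unfolding eq using int by (simp add: Bochner_Integration.integral_sum Bochner_Integration.integrable_sum)
  also have "\<dots> = (\<Sum>i\<in>UNIV. \<Sum>j\<in>UNIV. r $ i * r $ j * (if i = j then 1 / real CARD('m) else 0))"
    by (simp only: integral_mult_right_zero std_normal_family_direction_moment[OF V])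
  also have "\<dots> = (r \<bullet> r) / real CARD('m)"
    by (simp add: inner_vec_def sum_divide_distrib if_distrib[of "\<lambda>c. _ * c"] cong: if_cong)
  finally show "expectation (\<lambda>\<omega>. (V \<omega> \<bullet> r)\<^sup>2 / (V \<omega> \<bullet> V \<omega>)) = (r \<bullet> r) / real CARD('m)" .
qed

end

subsection \<open>Almost sure invertibility\<close>

text \<open>Polynomial functions of a family of real variables, given by closure rules: determinants
  are recognised by introduction rules, and one-variable slices reduce to
  \<open>poly\<close>.\<close>

inductive poly_map :: "(('i \<Rightarrow> real) \<Rightarrow> real) \<Rightarrow> bool" where
  const: "poly_map (\<lambda>_. c)"
| coord: "poly_map (\<lambda>x. x i)"
| add: "poly_map f \<Longrightarrow> poly_map g \<Longrightarrow> poly_map (\<lambda>x. f x + g x)"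
| mult: "poly_map f \<Longrightarrow> poly_map g \<Longrightarrow> poly_map (\<lambda>x. f x * g x)"

lemma poly_map_sum: "(\<And>a. a \<in> S \<Longrightarrow> poly_map (f a)) \<Longrightarrow> poly_map (\<lambda>x. \<Sum>a\<in>S. f a x)"
  by (induction S rule: infinite_finite_induct) (simp_all add: poly_map.intros)

lemma poly_map_prod: "(\<And>a. a \<in> S \<Longrightarrow> poly_map (f a)) \<Longrightarrow> poly_map (\<lambda>x. \<Prod>a\<in>S. f a x)"
  by (induction S rule: infinite_finite_induct) (simp_all add: poly_map.intros)

lemma poly_map_measurable:
  "poly_map f \<Longrightarrow> f \<in> borel_measurable (\<Pi>\<^sub>M i\<in>UNIV. borel)"
  by (induction rule: poly_map.induct) auto

lemma poly_map_coordinate: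
  "poly_map f \<Longrightarrow> \<exists>p. \<forall>t. f (x(i := t)) = poly p t"
proof (induction rule: poly_map.induct)
  case (const c)
  then show ?case by (intro exI[of _ "[:c:]"]) simp
next
  case (coord j)
  show ?case
  proof (cases "j = i")
    case True
    then show ?thesis by (intro exI[of _ "[:0, 1:]"]) simp
  next
    case False
    then show ?thesis by (intro exI[of _ "[:x j:]"]) simp
  qed
next
  case (add f g)
  then show ?case by (metis poly_add)
next
  case (mult f g)
  then show ?case by (metis poly_mult)
qed

text \<open>Coordinates outside \<open>I\<close> are frozen at \<open>z\<close>, so the empty case
  is \<open>f z \<noteq> 0\<close> and each induction step releases one coordinate. By Fubini it
  suffices that almost every slice in that coordinate is a nonzero polynomial, whose finitely many
  roots are a null set.\<close>

lemma poly_map_AE_neq_0_aux: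
  fixes f :: "('i \<Rightarrow> real) \<Rightarrow> real"
  assumes f: "poly_map f" and z: "f z \<noteq> 0"
  shows "finite I \<Longrightarrow> AE x in (\<Pi>\<^sub>M i\<in>I. std_normal). f (\<lambda>j. if j \<in> I then x j else z j) \<noteq> 0"
proof (induction I rule: finite_induct)
  case empty
  then show ?case using z by simp
next
  case (insert i I)
  interpret S: prob_space std_normal by (rule prob_space_std_normal)
  interpret product_prob_space "\<lambda>_::'i. std_normal" by standard
  let ?e = "\<lambda>I x j. if j \<in> I then x j else z j"
  have e: "?e J \<in> measurable (\<Pi>\<^sub>M i\<in>J. std_normal) (\<Pi>\<^sub>M i\<in>UNIV. borel)" for J
  proof (rule measurable_PiM_single')
    fix j
    have "(\<lambda>x. x j) \<in> borel_measurable (\<Pi>\<^sub>M i\<in>J. std_normal)" if "j \<in> J"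
      using measurable_component_singleton[OF that, of "\<lambda>_. std_normal"]
      by (simp cong: measurable_cong_sets)
    then show "(\<lambda>x. ?e J x j) \<in> borel_measurable (\<Pi>\<^sub>M i\<in>J. std_normal)" by (cases "j \<in> J") auto
  qed auto
  have fe: "(\<lambda>x. f (?e J x)) \<in> borel_measurable (\<Pi>\<^sub>M i\<in>J. std_normal)" for J
    using measurable_compose[OF e poly_map_measurable[OF f]] .
  let ?J = "insert i I"
  define h :: "('i \<Rightarrow> real) \<Rightarrow> ennreal" where "h x = (if f (?e ?J x) = 0 then 1 else 0)" for x
  have h: "h \<in> borel_measurable (\<Pi>\<^sub>M i\<in>?J. std_normal)"
    unfolding h_def using fe[of ?J] by measurable
  have "(\<integral>\<^sup>+x. h x \<partial>(\<Pi>\<^sub>M i\<in>?J. std_normal))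
    = (\<integral>\<^sup>+x. (\<integral>\<^sup>+t. h (x(i := t)) \<partial>std_normal) \<partial>(\<Pi>\<^sub>M i\<in>I. std_normal))"
    using insert.hyps h by (rule product_nn_integral_insert)
  also have "\<dots> = (\<integral>\<^sup>+x. 0 \<partial>(\<Pi>\<^sub>M i\<in>I. std_normal))"
  proof (rule nn_integral_cong_AE)
    show "AE x in (\<Pi>\<^sub>M i\<in>I. std_normal). (\<integral>\<^sup>+t. h (x(i := t)) \<partial>std_normal) = 0"
      using insert.IH
    proof eventually_elim
      case (elim x)
      obtain p where p: "\<And>t. f ((?e I x)(i := t)) = poly p t"
        using poly_map_coordinate[OF f] by metis
      have upd: "(?e I x)(i := z i) = ?e I x" using insert.hyps(2) by auto
      \<comment> \<open>At \<open>t = z i\<close> the slice is back at the point with only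
        \<open>I\<close> released, where the induction hypothesis applies.\<close>
      have "poly p (z i) \<noteq> 0" using elim p[of "z i"] upd by metis
      then have "p \<noteq> 0" by auto
      then have "AE t in std_normal. t \<notin> {t. poly p t = 0}"
        by (intro AE_std_normal_finite poly_roots_finite)
      moreover have "?e ?J (x(i := t)) = (?e I x)(i := t)" for t by auto
      ultimately have "AE t in std_normal. h (x(i := t)) = 0"
        by (auto simp: h_def p)
      then have "(\<integral>\<^sup>+t. h (x(i := t)) \<partial>std_normal) = (\<integral>\<^sup>+t. 0 \<partial>std_normal)"
        by (rule nn_integral_cong_AE)
      then show ?case by simp
    qed
  qed
  finally have "AE x in (\<Pi>\<^sub>M i\<in>?J. std_normal). h x = 0"
    using h by (simp add: nn_integral_0_iff_AE)
  then show ?case by eventually_elim (auto simp: h_def split: if_splits)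
qed

lemma poly_map_AE_neq_0:
  fixes f :: "('i::finite \<Rightarrow> real) \<Rightarrow> real"
  assumes "poly_map f" and "f z \<noteq> 0"
  shows "AE x in (\<Pi>\<^sub>M i\<in>UNIV. std_normal). f x \<noteq> 0"
  using poly_map_AE_neq_0_aux[where f = f and z = z and I = UNIV, OF assms] by simp

lemma poly_map_matrix_mult:
  fixes F :: "('i \<Rightarrow> real) \<Rightarrow> real^'n^'m" and H :: "('i \<Rightarrow> real) \<Rightarrow> real^'k^'n"
  assumes "\<And>i j. poly_map (\<lambda>x. F x $ i $ j)" "\<And>i j. poly_map (\<lambda>x. H x $ i $ j)"
  shows "poly_map (\<lambda>x. (F x ** H x) $ i $ j)"
  unfolding matrix_matrix_mult_def using assms by (simp add: poly_map_sum poly_map.mult)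

lemma poly_map_det:
  fixes F :: "('i \<Rightarrow> real) \<Rightarrow> real^'n^'n"
  assumes "\<And>i j. poly_map (\<lambda>x. F x $ i $ j)"
  shows "poly_map (\<lambda>x. det (F x))"
  unfolding det_def using assms by (intro poly_map_sum poly_map.mult poly_map_prod poly_map.const)

lemma (in prob_space) AE_invertible_sketch_gram:
  fixes A :: "real^'n^'m" and W :: "'a \<Rightarrow> real^'l^'m"
  assumes G: "sym_pos_def_mat G" and A: "inj ((*v) A)" and l: "CARD('l) \<le> CARD('n)"
    and W: "std_normal_family (\<lambda>(r, c) \<omega>. W \<omega> $ r $ c)"
  shows "AE \<omega> in M. invertible (sketch_gram A G (W \<omega>))"
proof -
  define F where "F x = (\<chi> r c. x (r, c))" for x :: "'m \<times> 'l \<Rightarrow> real"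
  let ?f = "\<lambda>x. det (sketch_gram A G (F x))"
  have "poly_map ?f"
    by (intro poly_map_det poly_map_matrix_mult) (simp_all add: F_def transpose_def poly_map.intros)
  moreover obtain W0 :: "real^'l^'m" where "invertible (sketch_gram A G W0)"
    using exists_invertible_sketch_gram[OF G A l] by blast
  then have "?f (\<lambda>(r, c). W0 $ r $ c) \<noteq> 0" by (simp add: F_def invertible_det_nz)
  ultimately have "AE \<omega> in M. ?f (\<lambda>i. case i of (r, c) \<Rightarrow> W \<omega> $ r $ c) \<noteq> 0"
    using std_normal_family_AE[OF W, of "\<lambda>x. ?f x \<noteq> 0"] poly_map_AE_neq_0[where f = ?f and z = "\<lambda>(r, c). W0 $ r $ c"] poly_map_measurable[of ?f]
    by (auto simp: case_prod_unfold)
  then show ?thesis by (simp add: F_def invertible_det_nz)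
qed

subsection \<open>Measurability of matrix operations\<close>

lemma borel_measurable_vec:
  fixes f :: "'a \<Rightarrow> 'b::euclidean_space^'n"
  assumes "\<And>i. (\<lambda>x. f x $ i) \<in> borel_measurable M"
  shows "f \<in> borel_measurable M"
  using assms by (subst borel_measurable_euclidean_space) (auto simp: Basis_vec_def inner_axis)

lemma borel_measurable_vec_nth [measurable (raw)]:
  fixes f :: "'a \<Rightarrow> 'b::euclidean_space^'n"
  assumes "f \<in> borel_measurable M"
  shows "(\<lambda>x. f x $ i) \<in> borel_measurable M"
  by (rule borel_measurable_continuous_on[OF _ assms]) (intro continuous_intros)

lemma borel_measurable_matrix_mult [measurable (raw)]:
  fixes F :: "'a \<Rightarrow> real^'n^'m" and H :: "'a \<Rightarrow> real^'k^'n"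
  assumes [measurable]: "F \<in> borel_measurable M" "H \<in> borel_measurable M"
  shows "(\<lambda>x. F x ** H x) \<in> borel_measurable M"
  by (intro borel_measurable_vec) (simp add: matrix_matrix_mult_def)

lemma borel_measurable_matrix_vector_mult [measurable (raw)]:
  fixes F :: "'a \<Rightarrow> real^'n^'m" and H :: "'a \<Rightarrow> real^'n"
  assumes [measurable]: "F \<in> borel_measurable M" "H \<in> borel_measurable M"
  shows "(\<lambda>x. F x *v H x) \<in> borel_measurable M"
  by (intro borel_measurable_vec) (simp add: matrix_vector_mult_def)

lemma borel_measurable_transpose [measurable (raw)]:
  fixes F :: "'a \<Rightarrow> real^'n^'m"
  assumes [measurable]: "F \<in> borel_measurable M"
  shows "(\<lambda>x. transpose (F x)) \<in> borel_measurable M"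
  by (intro borel_measurable_vec) (simp add: transpose_def)

lemma borel_measurable_det [measurable (raw)]:
  fixes F :: "'a \<Rightarrow> real^'n^'n"
  assumes [measurable]: "F \<in> borel_measurable M"
  shows "(\<lambda>x. det (F x)) \<in> borel_measurable M"
  unfolding det_def by measurable

text \<open>\<open>matrix_inv\<close> is defined by choice, so its measurability is not visible.
  Cramer's rule gives a formula off the zero set of \<open>det\<close>, and on that set the value is
  one constant.\<close>

lemma matrix_inv_cramer:
  fixes A :: "real^'n^'n"
  shows "matrix_inv A = (if det A = 0 then matrix_inv 0 else
    (\<chi> i j. det (\<chi> r c. if c = i then axis j 1 $ r else A $ r $ c) / det A))"
proof (cases "det A = 0")
  case True
  \<comment> \<open>For a singular matrix the choice is made from the empty predicate.\<close>
  moreover have "mat 0 = (0 :: real^'n^'n)" by (simp add: mat_def vec_eq_iff)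
  then have "det (0 :: real^'n^'n) = 0" by (metis det_0)
  ultimately have "\<not> invertible A" "\<not> invertible (0 :: real^'n^'n)"
    by (simp_all add: invertible_det_nz)
  then have "(\<lambda>A'. A ** A' = mat 1 \<and> A' ** A = mat 1) = (\<lambda>A'. 0 ** A' = mat 1 \<and> A' ** 0 = mat 1)"
    unfolding invertible_def by blast
  then show ?thesis using True by (simp add: matrix_inv_def)
next
  case False
  then have "A *v (matrix_inv A *v axis j 1) = axis j 1" for j
    using matrix_inv_right_left[of A] by (simp add: invertible_det_nz matrix_vector_mul_assoc)
  then have "matrix_inv A *v axis j 1 = (\<chi> k. det (\<chi> r c. if c = k then axis j 1 $ r else A $ r $ c) / det A)" for j
    using cramer[OF False] by blast
  then have "column j (matrix_inv A) $ i = det (\<chi> r c. if c = i then axis j 1 $ r else A $ r $ c) / det A" for i j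
    by (simp add: matrix_vector_mult_basis)
  then show ?thesis using False by (simp add: column_def vec_eq_iff)
qed

lemma borel_measurable_matrix_inv [measurable (raw)]:
  fixes F :: "'a \<Rightarrow> real^'n^'n"
  assumes [measurable]: "F \<in> borel_measurable M"
  shows "(\<lambda>x. matrix_inv (F x)) \<in> borel_measurable M"
proof -
  have "(\<lambda>x. (\<chi> r c. if c = i then axis j 1 $ r else F x $ r $ c) :: real^'n^'n) \<in> borel_measurable M" for i j :: 'n
    by (intro borel_measurable_vec) simp
  then have "(\<lambda>x. (\<chi> i j. det (\<chi> r c. if c = i then axis j 1 $ r else F x $ r $ c) / det (F x)) :: real^'n^'n)
      \<in> borel_measurable M"
    by (intro borel_measurable_vec) simp
  then show ?thesis
    unfolding matrix_inv_cramer[of "F _"] by measurable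
qed

text \<open>Restricting the assumption to \<open>j < k\<close> matters: the lemma is applied on a
  product space that has coordinates for the past sketches only.\<close>

lemma borel_measurable_Tprod:
  assumes "\<And>j. j < k \<Longrightarrow> (\<lambda>x. W x j) \<in> borel_measurable M"
  shows "(\<lambda>x. Tprod A G (W x) k) \<in> borel_measurable M"
  using assms
proof (induction k)
  case (Suc k)
  then have [measurable]: "(\<lambda>x. Tprod A G (W x) k) \<in> borel_measurable M" "(\<lambda>x. W x k) \<in> borel_measurable M"
    by simp_all
  show ?case by (simp add: Tmat_def)
qed simp

lemma Tprod_cong: "(\<And>j. j < k \<Longrightarrow> W j = W' j) \<Longrightarrow> Tprod A G W k = Tprod A G W' k"
  by (induction k) simp_all

subsection \<open>Expected contraction\<close>

context prob_space
begin

lemma expected_sketch_step_bound: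
  fixes A :: "real^'n^'m" and V :: "'a \<Rightarrow> real^'m"
  assumes G: "sym_pos_def_mat G" and A: "inj ((*v) A)"
    and V: "std_normal_family (\<lambda>i \<omega>. V \<omega> $ i)"
  defines "L \<equiv> lambda_max (precond_gram A G)"
  shows "(\<integral>\<^sup>+\<omega>. ennreal (sqnormM (matrix_inv G) y - (V \<omega> \<bullet> (A *v y))\<^sup>2 / (L * (V \<omega> \<bullet> V \<omega>))) \<partial>M)
    \<le> ennreal (1 - 1 / (real CARD('m) * kappa A G)) * ennreal (sqnormM (matrix_inv G) y)"
proof -
  let ?n = "sqnormM (matrix_inv G) y"
  let ?r = "A *v y"
  define q where "q \<omega> = (V \<omega> \<bullet> ?r)\<^sup>2 / (V \<omega> \<bullet> V \<omega>)" for \<omega>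
  have q_int: "integrable M q" and q_E: "expectation q = (?r \<bullet> ?r) / real CARD('m)"
    using std_normal_vector_direction_moment[OF V, of ?r] by (simp_all add: q_def[abs_def])
  let ?l = "lambda_min (precond_gram A G)"
  have l: "0 < ?l" "?l \<le> L" using precond_gram_lambda[OF G A] by (simp_all add: L_def)
  then have L: "0 < L" by simp
  have q: "(V \<omega> \<bullet> ?r)\<^sup>2 / (L * (V \<omega> \<bullet> V \<omega>)) = q \<omega> / L" for \<omega> by (simp add: q_def)
  \<comment> \<open>This makes the integrand below nonnegative, so that truncation in
    \<open>ennreal\<close> changes nothing and the integral can be computed as a Bochner
    integral.\<close>
  have "q \<omega> \<le> L * ?n" for \<omega>
  proof -
    have "q \<omega> \<le> ?r \<bullet> ?r"
    proof (cases "V \<omega> = 0")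
      case False
      then show ?thesis using Cauchy_Schwarz_ineq[of "V \<omega>" ?r] by (simp add: q_def divide_le_eq mult.commute)
    qed (simp add: q_def)
    also have "\<dots> \<le> L * ?n" unfolding L_def by (rule residual_le_lambda_max[OF G])
    finally show ?thesis .
  qed
  then have "q \<omega> / L \<le> ?n" for \<omega>
    by (subst pos_divide_le_eq[OF L]) (metis mult.commute)
  then have nonneg: "0 \<le> ?n - q \<omega> / L" for \<omega>
    by (simp only: diff_ge_0_iff_ge)
  have "(\<integral>\<^sup>+\<omega>. ennreal (?n - q \<omega> / L) \<partial>M) = ennreal (\<integral>\<omega>. ?n - q \<omega> / L \<partial>M)"
    using q_int nonneg
    by (intro nn_integral_eq_integral) auto
  also have "(\<integral>\<omega>. ?n - q \<omega> / L \<partial>M) = ?n - (?r \<bullet> ?r) / real CARD('m) / L"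
    using q_int by (simp add: q_E prob_space)
  also have "\<dots> \<le> ?n - (?l * ?n) / real CARD('m) / L"
    using residual_ge_lambda_min[OF G, of A y] L by (intro diff_left_mono divide_right_mono) auto
  also have "\<dots> = (1 - 1 / (real CARD('m) * kappa A G)) * ?n"
    using l L by (simp add: kappa_def Let_def L_def[symmetric] field_simps)
  finally have "(\<integral>\<^sup>+\<omega>. ennreal (?n - q \<omega> / L) \<partial>M) \<le> ennreal ((1 - 1 / (real CARD('m) * kappa A G)) * ?n)"
    by (simp add: ennreal_leI)
  then show ?thesis
    unfolding q using sqnormM_inv_nonneg[OF G, of y] by (simp add: ennreal_mult'')
qed

text \<open>The pathwise bound involves the sketch only through one column, so the product law of
  error and column suffices: by Fubini the error is frozen at \<open>y\<close> and
  \<open>expected_sketch_step_bound\<close> applies to the inner integral.\<close>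

lemma indep_sketch_step_contracts:
  fixes A :: "real^'n^'m" and W :: "'a \<Rightarrow> real^'l^'m" and Y :: "'a \<Rightarrow> real^'n"
  assumes G: "sym_pos_def_mat G" and A: "inj ((*v) A)"
    and V: "std_normal_family (\<lambda>i \<omega>. column c (W \<omega>) $ i)"
    and inv: "AE \<omega> in M. invertible (sketch_gram A G (W \<omega>))"
    and meas: "Y \<in> borel_measurable M" "(\<lambda>\<omega>. column c (W \<omega>)) \<in> borel_measurable M"
    and joint: "distr M borel Y \<Otimes>\<^sub>M distr M borel (\<lambda>\<omega>. column c (W \<omega>))
      = distr M (borel \<Otimes>\<^sub>M borel) (\<lambda>\<omega>. (Y \<omega>, column c (W \<omega>)))"
  shows "(\<integral>\<^sup>+\<omega>. ennreal (sqnormM (matrix_inv G) (Tmat A G (W \<omega>) *v Y \<omega>)) \<partial>M)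
    \<le> ennreal (1 - 1 / (real CARD('m) * kappa A G)) * (\<integral>\<^sup>+\<omega>. ennreal (sqnormM (matrix_inv G) (Y \<omega>)) \<partial>M)"
proof -
  let ?n = "sqnormM (matrix_inv G)"
  let ?V = "\<lambda>\<omega>. column c (W \<omega>)"
  define h where "h = (\<lambda>(y, v). ennreal (?n y
    - (v \<bullet> (A *v y))\<^sup>2 / (lambda_max (precond_gram A G) * (v \<bullet> v))))"
  note [measurable] = meas
  have n [measurable]: "?n \<in> borel_measurable borel" unfolding sqnormM_def by measurable
  have h [measurable]: "h \<in> borel_measurable (borel \<Otimes>\<^sub>M borel)" unfolding h_def by measurable
  interpret DV: prob_space "distr M borel ?V" by (rule prob_space_distr) measurable
  have "(\<integral>\<^sup>+\<omega>. ennreal (?n (Tmat A G (W \<omega>) *v Y \<omega>)) \<partial>M) \<le> (\<integral>\<^sup>+\<omega>. h (Y \<omega>, ?V \<omega>) \<partial>M)"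
    using inv by (intro nn_integral_mono_AE)
      (auto simp: h_def intro!: ennreal_leI sketch_step_sqnorm_le[OF G A])
  also have "\<dots> = (\<integral>\<^sup>+z. h z \<partial>(distr M borel Y \<Otimes>\<^sub>M distr M borel ?V))"
    unfolding joint by (subst nn_integral_distr) auto
  also have "\<dots> = (\<integral>\<^sup>+y. (\<integral>\<^sup>+v. h (y, v) \<partial>distr M borel ?V) \<partial>distr M borel Y)"
    by (subst DV.nn_integral_fst) auto
  also have "\<dots> = (\<integral>\<^sup>+y. (\<integral>\<^sup>+\<omega>. h (y, ?V \<omega>) \<partial>M) \<partial>distr M borel Y)"
    by (subst nn_integral_distr) auto
  also have "\<dots> \<le> (\<integral>\<^sup>+y. ennreal (1 - 1 / (real CARD('m) * kappa A G)) * ennreal (?n y) \<partial>distr M borel Y)"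
    unfolding h_def prod.case by (intro nn_integral_mono expected_sketch_step_bound[OF G A V])
  also have "\<dots> = ennreal (1 - 1 / (real CARD('m) * kappa A G)) * (\<integral>\<^sup>+\<omega>. ennreal (?n (Y \<omega>)) \<partial>M)"
    by (subst nn_integral_distr) (auto simp: nn_integral_cmult)
  finally show ?thesis .
qed

lemma indep_var_compose_distr:
  assumes indep: "indep_var S X T Z" and f: "f \<in> measurable S S'" and g: "g \<in> measurable T T'"
  shows "distr M S' (f \<circ> X) \<Otimes>\<^sub>M distr M T' (g \<circ> Z) = distr M (S' \<Otimes>\<^sub>M T') (\<lambda>\<omega>. (f (X \<omega>), g (Z \<omega>)))"
proof -
  have X: "X \<in> measurable M S" and Z: "Z \<in> measurable M T"
    using indep by (auto dest: indep_var_rv1 indep_var_rv2)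
  have joint: "distr M S X \<Otimes>\<^sub>M distr M T Z = distr M (S \<Otimes>\<^sub>M T) (\<lambda>\<omega>. (X \<omega>, Z \<omega>))"
    using indep by (simp add: indep_var_distribution_eq)
  interpret DZ: prob_space "distr M T Z" by (rule prob_space_distr) (rule Z)
  interpret DgZ: prob_space "distr (distr M T Z) T' g" by (rule DZ.prob_space_distr) (simp add: g)
  have "distr M S' (f \<circ> X) \<Otimes>\<^sub>M distr M T' (g \<circ> Z)
      = distr (distr M S X) S' f \<Otimes>\<^sub>M distr (distr M T Z) T' g"
    by (simp add: distr_distr f g X Z)
  also have "\<dots> = distr (distr M S X \<Otimes>\<^sub>M distr M T Z) (S' \<Otimes>\<^sub>M T') (\<lambda>(x, z). (f x, g z))"
    using f g DgZ.sigma_finite_measure_axioms by (intro pair_measure_distr) auto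
  also have "\<dots> = distr M (S' \<Otimes>\<^sub>M T') (\<lambda>\<omega>. (f (X \<omega>), g (Z \<omega>)))"
    unfolding joint using f g X Z by (subst distr_distr) (auto simp: comp_def)
  finally show ?thesis .
qed

text \<open>The entries split into the disjoint blocks \<open>?P\<close> (sketches before
  \<open>k\<close>) and \<open>?Q\<close> (sketch \<open>k\<close>). The error is a function of the
  first block and the column a function of the second.\<close>

lemma Tprod_indep_column:
  fixes Om :: "nat \<Rightarrow> 'a \<Rightarrow> real^'l^'m" and A :: "real^'n^'m"
  assumes indep: "indep_vars (\<lambda>_. borel) (\<lambda>(j, r, c) \<omega>. Om j \<omega> $ r $ c) UNIV"
  shows "distr M borel (\<lambda>\<omega>. Tprod A G (\<lambda>j. Om j \<omega>) k *v e) \<Otimes>\<^sub>M distr M borel (\<lambda>\<omega>. column c (Om k \<omega>))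
    = distr M (borel \<Otimes>\<^sub>M borel) (\<lambda>\<omega>. (Tprod A G (\<lambda>j. Om j \<omega>) k *v e, column c (Om k \<omega>)))"
proof -
  let ?X = "\<lambda>(j, r, c) \<omega>. Om j \<omega> $ r $ c"
  let ?P = "{..<k} \<times> UNIV :: (nat \<times> 'm \<times> 'l) set"
  let ?Q = "{k} \<times> UNIV :: (nat \<times> 'm \<times> 'l) set"
  define g :: "(nat \<times> 'm \<times> 'l \<Rightarrow> real) \<Rightarrow> real^'n"
    where "g p = Tprod A G (\<lambda>j. \<chi> r c. p (j, r, c)) k *v e" for p
  define f :: "(nat \<times> 'm \<times> 'l \<Rightarrow> real) \<Rightarrow> real^'m" where "f p = (\<chi> r. p (k, r, c))" for p
  have "(\<lambda>p. (\<chi> r c. p (j, r, c)) :: real^'l^'m) \<in> borel_measurable (PiM ?P (\<lambda>_. borel))" if "j < k" for j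
    using that by (intro borel_measurable_vec) (auto intro!: measurable_component_singleton)
  then have "(\<lambda>p. Tprod A G (\<lambda>j. (\<chi> r c. p (j, r, c)) :: real^'l^'m) k) \<in> borel_measurable (PiM ?P (\<lambda>_. borel))"
    by (rule borel_measurable_Tprod)
  then have g: "g \<in> borel_measurable (PiM ?P (\<lambda>_. borel))"
    unfolding g_def by (rule borel_measurable_matrix_vector_mult) simp
  have f: "f \<in> borel_measurable (PiM ?Q (\<lambda>_. borel))"
    unfolding f_def by (intro borel_measurable_vec) (auto intro!: measurable_component_singleton)
  have "g (restrict (\<lambda>i. ?X i \<omega>) ?P) = Tprod A G (\<lambda>j. Om j \<omega>) k *v e" for \<omega>
  proof -
    \<comment> \<open>Outside \<open>?P\<close> the restricted family is \<open>undefined\<close>,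
      but \<open>Tprod\<close> at \<open>k\<close> reads only sketches with index below
      \<open>k\<close>.\<close>
    have "Tprod A G (\<lambda>j. \<chi> r c. restrict (\<lambda>i. ?X i \<omega>) ?P (j, r, c)) k = Tprod A G (\<lambda>j. Om j \<omega>) k"
      by (rule Tprod_cong) (simp add: vec_eq_iff)
    then show ?thesis by (simp add: g_def)
  qed
  moreover have "f (restrict (\<lambda>i. ?X i \<omega>) ?Q) = column c (Om k \<omega>)" for \<omega>
    by (simp add: f_def column_def)
  moreover have "?P \<inter> ?Q = {}" by auto
  ultimately show ?thesis
    using indep_var_compose_distr[OF indep_var_restrict[OF indep] g f] by (simp add: comp_def)
qed

end

section \<open>One-step contraction, geometric decay and convergence\<close>

theorem mainTheorem7:
  fixes A :: "real^'n^'m" and b :: "real^'m" and xstar x0 :: "real^'n"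
    and G :: "real^'n^'n" and M :: "'w measure"
    and Om :: "nat \<Rightarrow> 'w \<Rightarrow> real^'l^'m"
  assumes "CARD('n) \<le> CARD('m)"
    and "rank A = CARD('n)"
    and "A *v xstar = b"
    and "sym_pos_def_mat G"
    and "CARD('l) \<le> CARD('n)"
    and "prob_space M"
    and "prob_space.indep_vars M (\<lambda>_. borel)
           (\<lambda>(j, r, c) \<omega>. Om j \<omega> $ r $ c) (UNIV :: (nat \<times> 'm \<times> 'l) set)"
    and "\<And>j r c. distributed M lborel (\<lambda>\<omega>. Om j \<omega> $ r $ c) std_normal_density"
  shows "1 - 1 / (real CARD('m) * kappa A G) < 1
    \<and> (\<forall>k. (\<integral>\<^sup>+ \<omega>. ennreal (sqnormM (matrix_inv G) (Tprod A G (\<lambda>j. Om j \<omega>) (Suc k) *v (x0 - xstar))) \<partial>M)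
          \<le> ennreal (1 - 1 / (real CARD('m) * kappa A G)) *
            (\<integral>\<^sup>+ \<omega>. ennreal (sqnormM (matrix_inv G) (Tprod A G (\<lambda>j. Om j \<omega>) k *v (x0 - xstar))) \<partial>M))
    \<and> (\<forall>k. (\<integral>\<^sup>+ \<omega>. ennreal (sqnormM (matrix_inv G) (Tprod A G (\<lambda>j. Om j \<omega>) (Suc k) *v (x0 - xstar))) \<partial>M)
          \<le> ennreal ((1 - 1 / (real CARD('m) * kappa A G)) ^ (Suc k) * sqnormM (matrix_inv G) (x0 - xstar)))
    \<and> (\<forall>k \<omega>. iter A b G (\<lambda>j. Om j \<omega>) x0 k - xstar = Tprod A G (\<lambda>j. Om j \<omega>) k *v (x0 - xstar))
    \<and> ((\<lambda>k. \<integral>\<^sup>+ \<omega>. ennreal (sqnormM (matrix_inv G) (iter A b G (\<lambda>j. Om j \<omega>) x0 k - xstar)) \<partial>M)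
          \<longlonglongrightarrow> 0)"
proof -
  interpret prob_space M by fact
  note G = assms(4)
  have A: "inj ((*v) A)" using assms(2) by (simp add: full_rank_injective)
  define \<rho> where "\<rho> = 1 - 1 / (real CARD('m) * kappa A G)"
  define e where "e = x0 - xstar"
  let ?n = "sqnormM (matrix_inv G)"
  \<comment> \<open>\<open>Tprod\<close> at \<open>k\<close> has the factors
    \<open>0, ..., k - 1\<close>, so \<open>?I k\<close> belongs to the error after \<open>k\<close>
    steps and the passage to \<open>Suc k\<close> uses the fresh sketch \<open>Om k\<close>.\<close>
  let ?I = "\<lambda>k. \<integral>\<^sup>+ \<omega>. ennreal (?n (Tprod A G (\<lambda>j. Om j \<omega>) k *v e)) \<partial>M"
  \<comment> \<open>Besides \<open>\<rho> < 1\<close> this yields \<open>0 \<le> \<rho>\<close>,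
    which lets \<open>ennreal\<close> commute with the products and powers of the rate.\<close>
  have "1 \<le> real CARD('m) * kappa A G"
    using kappa_ge_1[OF G A] mult_mono[of 1 "real CARD('m)" 1 "kappa A G"] by simp
  then have \<rho>: "0 \<le> \<rho>" "\<rho> < 1" by (auto simp: \<rho>_def divide_le_eq_1)
  have X: "std_normal_family (\<lambda>(j, r, c) \<omega>. Om j \<omega> $ r $ c)"
    unfolding std_normal_family_def using assms(7,8) by (auto simp: case_prod_unfold)
  have step: "?I (Suc k) \<le> ennreal \<rho> * ?I k" for k
  proof -
    have "std_normal_family (\<lambda>(r, c) \<omega>. Om k \<omega> $ r $ c)"
      using std_normal_family_reindex[OF X, of "\<lambda>i. (k, i)"] by (simp add: inj_def case_prod_unfold)
    then have inv: "AE \<omega> in M. invertible (sketch_gram A G (Om k \<omega>))"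
      by (rule AE_invertible_sketch_gram[OF G A assms(5)])
    have entry: "(\<lambda>\<omega>. Om j \<omega> $ r $ c) \<in> borel_measurable M" for j r c
      using std_normal_family_measurable[OF X, of "(j, r, c)"] by simp
    then have "Om j \<in> borel_measurable M" for j
      by (intro borel_measurable_vec)
    then have "(\<lambda>\<omega>. Tprod A G (\<lambda>j. Om j \<omega>) k *v e) \<in> borel_measurable M"
      by (intro borel_measurable_matrix_vector_mult borel_measurable_Tprod) simp_all
    \<comment> \<open>The index \<open>c\<close> stays free: any column serves, and the resulting
      contraction does not mention it.\<close>
    moreover have "(\<lambda>\<omega>. column c (Om k \<omega>)) \<in> borel_measurable M" for c
      unfolding column_def by (intro borel_measurable_vec) (simp add: entry)
    moreover have "std_normal_family (\<lambda>i \<omega>. column c (Om k \<omega>) $ i)" for c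
      using std_normal_family_reindex[OF X, of "\<lambda>i. (k, i, c)"] by (simp add: inj_def column_def)
    ultimately show ?thesis
      using indep_sketch_step_contracts[OF G A _ inv _ _ Tprod_indep_column[OF assms(7)]] by (simp add: \<rho>_def matrix_vector_mul_assoc)
  qed
  have bound: "?I k \<le> ennreal (\<rho> ^ k * ?n e)" for k
  proof (induction k)
    case 0
    show ?case by (simp add: emeasure_space_1)
  next
    case (Suc k)
    have "?I (Suc k) \<le> ennreal \<rho> * ennreal (\<rho> ^ k * ?n e)"
      using step[of k] Suc by (meson mult_left_mono order_trans zero_le)
    then show ?case
      using \<rho>(1) sqnormM_inv_nonneg[OF G, of e] by (simp add: ennreal_mult'[symmetric] mult.assoc)
  qed
  have error: "iter A b G (\<lambda>j. Om j \<omega>) x0 k - xstar = Tprod A G (\<lambda>j. Om j \<omega>) k *v e" for k \<omega>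
    unfolding e_def by (rule iter_error_eq[OF assms(3)])
  have "(\<lambda>k. \<rho> ^ k * ?n e) \<longlonglongrightarrow> 0 * ?n e"
    using \<rho> by (intro tendsto_mult LIMSEQ_power_zero tendsto_const) simp
  then have "(\<lambda>k. ennreal (\<rho> ^ k * ?n e)) \<longlonglongrightarrow> ennreal 0"
    by (intro tendsto_ennrealI) simp
  then have "(\<lambda>k. ennreal (\<rho> ^ k * ?n e)) \<longlonglongrightarrow> 0" by simp
  then have lim: "?I \<longlonglongrightarrow> 0"
    by (rule tendsto_sandwich[OF _ _ tendsto_const, rotated 2]) (simp_all only: bound eventually_True zero_le)
  show ?thesis
    unfolding \<rho>_def[symmetric] e_def[symmetric] error
    by (intro conjI allI; rule \<rho>(2) step bound lim refl)
qed

end
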